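(* Suppose $f$ is a non-constant entire function of order zero. Then for any sector $S$ of opening $\alpha$, \[ \liminf_{r\to\infty}A(r,S,f)\ \le\ \frac{\alpha}{2\pi}\ \le\ \limsup_{r\to\infty}A(r,S,f). \]
   Context: A sector is a set $S=\{w\in\mathbb{C}: 0<|w|<\infty,\ \theta_1<\arg w<\theta_2\}$ with vertex at the origin; its opening is $\alpha=\theta_2-\theta_1\in(0,2\pi]$. For an entire function $f$, write $r\mathbb{D}=\{z\in\mathbb{C}:|z|<r\}$ and define the relative area of the preimage \[ A(r,S,f)=\frac{\operatorname{Area}(f^{-1}S\cap r\mathbb{D})}{\operatorname{Area}(r\mathbb{D})}. \] Entire functions are assumed non-constant. The order of an entire function $f$ is $\rho=\limsup_{r\to\infty}\frac{\log\log M(r,f)}{\log r}$, where $M(r,f)=\max_{|z|\le r}|f(z)|$. *)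

theory Defs
  imports "HOL-Complex_Analysis.Complex_Analysis"
begin

text \<open>Here arg is multivalued: \<open>w\<close> belongs to the sector if some argument of \<open>w\<close> lies in the
  open interval.  The condition \<open>w \<noteq> 0\<close> is needed because every real is an \<^const>\<open>is_Arg\<close>
  of 0.\<close>

definition sector :: "real \<Rightarrow> real \<Rightarrow> complex set" where
  "sector \<theta>\<^sub>1 \<theta>\<^sub>2 = {w. w \<noteq> 0 \<and> (\<exists>\<theta>. is_Arg w \<theta> \<and> \<theta>\<^sub>1 < \<theta> \<and> \<theta> < \<theta>\<^sub>2)}"

definition relative_area :: "real \<Rightarrow> complex set \<Rightarrow> (complex \<Rightarrow> complex) \<Rightarrow> real" where
  "relative_area r S f =
     measure lebesgue (f -` S \<inter> ball 0 r) / measure lebesgue (ball (0::complex) r)"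

definition max_modulus :: "real \<Rightarrow> (complex \<Rightarrow> complex) \<Rightarrow> real" where
  "max_modulus r f = (SUP z\<in>cball 0 r. norm (f z))"

text \<open>For non-constant entire \<open>f\<close>, the maximum modulus tends to infinity, so the values of
  \<^const>\<open>ln\<close> at non-positive arguments play no role in the upper limit.\<close>

definition entire_order :: "(complex \<Rightarrow> complex) \<Rightarrow> ereal" where
  "entire_order f = Limsup at_top (\<lambda>r. ereal (ln (ln (max_modulus r f)) / ln r))"

end

theory Submission
  imports Defs
begin

text \<open>For a function of order zero there are arbitrarily large \<open>R\<close> such that most zeros \<open>a\<close> are
  either much smaller or much larger than \<open>R\<close>: with \<open>N\<close> the number of zeros in the disc of radius
  \<open>R\<close>, the sum of \<open>min (|a| / R) (R / |a|)\<close> over all zeros is at most \<open>\<epsilon> N\<close>. Since \<open>z f' / f\<close> is the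
  sum of the \<open>z / (z - a)\<close>, it is then close to the constant \<open>N\<close> in area mean over this disc. If \<open>g\<close> is
  a function of the direction of \<open>f\<close> with circular mean zero, then \<open>g Re (z f' / f)\<close> integrates to zero
  over every circle around the origin, because it is the angular derivative of a single-valued
  function of \<open>arg f\<close>. Hence the area mean of \<open>g\<close> equals that of \<open>g (1 - Re (z f' / f) / N)\<close>, which is
  small. Taking for \<open>g\<close> continuous approximations of the indicator of the sector from above and from
  below, minus their means, shows that the relative area comes arbitrarily close to
  \<open>\<alpha> / (2 \<pi>)\<close> from either side.\<close>

subsection \<open>Zeros and logarithmic derivatives of entire functions\<close>

text \<open>Order zero enters twice. And log M(r) = o(r) makes the zero-free part of f negligible in
  z f' / f once the zeros of a disc much larger than R have been divided out. The weight min(|a| /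
  R, R / |a|) bounds, up to a constant, the area mean over the disc of |z / (z - a) - 1| for zeros
  inside and of |z / (z - a)| for zeros outside. Means over the disc are taken because 1 / |z - a|
  is integrable for area but not along a circle through a. No branch of arg f is chosen: functions
  of the direction are written as \<psi> of cos(arg f - \<beta>) = Re(f e^(-i\<beta>)) / |f|, with
  \<beta> the direction of the bisector, and the sector is a superlevel set of this cosine.\<close>

text \<open>\<open>zor_poly\<close> provides the cofactor only near \<open>a\<close>. Away from
  \<open>a\<close> the quotient of \<open>f\<close> by the power is holomorphic, and the two agree
  on the overlap, so they glue to an entire function. If \<open>f a\<close> is nonzero, the exponent
  is 0.\<close>

lemma entire_factor_zero:
  fixes f :: "complex \<Rightarrow> complex"
  assumes "f holomorphic_on UNIV" "f w0 \<noteq> 0"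
  obtains h where "h holomorphic_on UNIV" "h a \<noteq> 0" "\<And>z. f z = (z - a) ^ nat (zorder f a) * h z"
proof -
  define n where "n = nat (zorder f a)"
  define g where "g = zor_poly f a"
  have "\<exists>w\<in>UNIV. f w \<noteq> 0" using assms(2) by blast
  then obtain r where "r > 0 \<and> cball a r \<subseteq> UNIV \<and> g holomorphic_on cball a r \<and>
      (\<forall>w\<in>cball a r. f w = g w * (w - a) ^ n \<and> g w \<noteq> 0)"
    using zorder_exist_zero[OF assms(1) open_UNIV connected_UNIV UNIV_I, of a]
    unfolding n_def g_def by blast
  then have r: "r > 0" "g holomorphic_on cball a r"
      "\<And>w. w \<in> cball a r \<Longrightarrow> f w = g w * (w - a) ^ n \<and> g w \<noteq> 0"
    by blast+
  define h where "h = (\<lambda>z. if z \<in> ball a r then g z else f z / (z - a) ^ n)"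
  have h_alt: "h z = f z / (z - a) ^ n" if "z \<noteq> a" for z
    using that r(3)[of z] by (auto simp: h_def)
  have "h holomorphic_on (ball a r \<union> (UNIV - {a}))"
  proof (rule holomorphic_on_Un)
    have "g holomorphic_on ball a r"
      by (rule holomorphic_on_subset[OF r(2)]) auto
    then show "h holomorphic_on ball a r"
      by (rule holomorphic_transform) (auto simp: h_def)
    have "(\<lambda>z. f z / (z - a) ^ n) holomorphic_on UNIV - {a}"
      by (intro holomorphic_intros holomorphic_on_subset[OF assms(1)]) auto
    then show "h holomorphic_on UNIV - {a}"
      by (rule holomorphic_transform) (auto simp: h_alt)
  qed auto
  moreover have "ball a r \<union> (UNIV - {a}) = UNIV" using r(1) by auto
  ultimately have "h holomorphic_on UNIV" by simp
  moreover have "h a \<noteq> 0" using r(1) r(3)[of a] by (auto simp: h_def)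
  moreover have "f z = (z - a) ^ n * h z" for z
  proof (cases "z = a")
    case True
    then show ?thesis using r(1) r(3)[of a] by (auto simp: h_def)
  next
    case False
    then show ?thesis by (simp add: h_alt)
  qed
  ultimately show ?thesis using that n_def by blast
qed

text \<open>Zeros are split off one at a time; the exponents remain those of the original
  \<open>f\<close> because dividing by factors with zeros elsewhere does not change the order at the
  next point.\<close>

lemma entire_factor_zeros:
  fixes f :: "complex \<Rightarrow> complex"
  assumes "f holomorphic_on UNIV" "f w0 \<noteq> 0" "finite A"
  obtains h where "h holomorphic_on UNIV" "\<And>a. a \<in> A \<Longrightarrow> h a \<noteq> 0"
    "\<And>z. f z = (\<Prod>a\<in>A. (z - a) ^ nat (zorder f a)) * h z"
proof -
  have "\<exists>h. h holomorphic_on UNIV \<and> (\<forall>a\<in>A. h a \<noteq> 0) \<and>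
          (\<forall>z. f z = (\<Prod>a\<in>A. (z - a) ^ nat (zorder f a)) * h z)"
    using \<open>finite A\<close>
  proof induction
    case empty
    then show ?case using assms by (intro exI[of _ f]) auto
  next
    case (insert b A)
    then obtain h where h: "h holomorphic_on UNIV" "\<And>a. a \<in> A \<Longrightarrow> h a \<noteq> 0"
      and fh: "\<And>z. f z = (\<Prod>a\<in>A. (z - a) ^ nat (zorder f a)) * h z" by auto
    have "h w0 \<noteq> 0" using assms(2) fh[of w0] by auto
    then obtain k where k: "k holomorphic_on UNIV" "k b \<noteq> 0"
      "\<And>z. h z = (z - b) ^ nat (zorder h b) * k z"
      using entire_factor_zero[OF h(1)] by metis
    define P where "P = (\<lambda>z. \<Prod>a\<in>A. (z - a) ^ nat (zorder f a))"
    have Phol: "P holomorphic_on UNIV" unfolding P_def by (intro holomorphic_intros)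
    have P0: "P b \<noteq> 0" using insert by (auto simp: P_def)
    \<comment> \<open>Orders are additive under products and \<open>P\<close> does not vanish at
      \<open>b\<close>, so the order of \<open>h\<close> at \<open>b\<close> is that of
      \<open>f\<close>.\<close>
    have "zorder f b = zorder (\<lambda>z. P z * h z) b"
      unfolding P_def by (rule arg_cong[where f = "\<lambda>f. zorder f b"]) (rule ext, rule fh)
    also have "\<dots> = zorder P b + zorder h b"
    proof (rule zorder_times_analytic)
      show "P analytic_on {b}" "h analytic_on {b}"
        using Phol h(1) by (auto intro: holomorphic_on_imp_analytic_at)
      have "eventually (\<lambda>z. f z \<noteq> 0) (at b)"
        using non_zero_neighbour_alt[of f UNIV b w0] assms by auto
      then show "eventually (\<lambda>z. P z * h z \<noteq> 0) (at b)"
        using fh by (simp add: P_def)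
    qed
    also have "zorder P b = 0"
      using Phol P0 by (intro zorder_eq_0I) (auto intro: holomorphic_on_imp_analytic_at)
    finally have zo: "zorder h b = zorder f b" by simp
    have "h a \<noteq> 0 \<Longrightarrow> k a \<noteq> 0" for a using k(3)[of a] by auto
    then have "\<forall>a\<in>insert b A. k a \<noteq> 0" using k(2) h(2) by blast
    moreover have "f z = (\<Prod>a\<in>insert b A. (z - a) ^ nat (zorder f a)) * k z" for z
      using fh[of z] k(3)[of z] zo insert.hyps by (simp add: mult_ac)
    ultimately show ?case using k(1) by blast
  qed
  then show ?thesis using that by blast
qed

section \<open>Logarithmic derivatives and their estimates\<close>

lemma deriv_over_self_mult:
  assumes "f field_differentiable at z" "g field_differentiable at z" "f z \<noteq> 0" "g z \<noteq> 0"
  shows "deriv (\<lambda>w. f w * g w) z / (f z * g z) = deriv f z / f z + deriv g z / (g z :: complex)"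
  using assms by (simp add: field_simps)

lemma deriv_over_self_prod:
  fixes z :: complex
  assumes "finite A" "z \<notin> A"
  shows "deriv (\<lambda>w. \<Prod>a\<in>A. (w - a) ^ m a) z / (\<Prod>a\<in>A. (z - a) ^ m a) = (\<Sum>a\<in>A. of_nat (m a) / (z - a))"
  using assms
proof induction
  case (insert b A)
  have "deriv (\<lambda>w. (w - b) ^ m b * (\<Prod>a\<in>A. (w - a) ^ m a)) z / ((z - b) ^ m b * (\<Prod>a\<in>A. (z - a) ^ m a)) =
    deriv (\<lambda>w. (w - b) ^ m b) z / (z - b) ^ m b +
    deriv (\<lambda>w. \<Prod>a\<in>A. (w - a) ^ m a) z / (\<Prod>a\<in>A. (z - a) ^ m a)"
  proof (rule deriv_over_self_mult)
    have "(\<lambda>w. \<Prod>a\<in>A. (w - a) ^ m a) holomorphic_on UNIV" by (intro holomorphic_intros)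
    then show "(\<lambda>w. \<Prod>a\<in>A. (w - a) ^ m a) field_differentiable at z"
      by (simp add: holomorphic_on_imp_differentiable_at)
    show "(\<lambda>w. (w - b) ^ m b) field_differentiable at z"
      by (intro derivative_intros)
  qed (use insert in auto)
  moreover have "deriv (\<lambda>w. (w - b) ^ m b) z = of_nat (m b) * (z - b) ^ (m b - 1)"
    by (rule DERIV_imp_deriv) (auto intro!: derivative_eq_intros)
  moreover have "of_nat (m b) * (z - b) ^ (m b - 1) / (z - b) ^ m b = of_nat (m b) / (z - b)"
    using insert by (cases "m b") (auto simp: field_simps)
  ultimately show ?case using insert by simp
qed simp

text \<open>A Borel--Caratheodory estimate for the logarithm of a zero-free function.\<close>

lemma deriv_over_self_bound:
  assumes h: "h holomorphic_on ball 0 \<rho>" "\<And>z. z \<in> ball 0 \<rho> \<Longrightarrow> h z \<noteq> 0"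
    and bd: "\<And>z. z \<in> ball 0 \<rho> \<Longrightarrow> norm (h z) \<le> exp \<Lambda>" and "\<rho> > 0" and z: "norm z \<le> \<rho> / 4"
  shows "norm (deriv h z / h z) \<le> 8 * (\<Lambda> + 1 - ln (norm (h 0))) / \<rho>"
proof -
  obtain L where L: "L holomorphic_on ball 0 \<rho>" "\<And>z. z \<in> ball 0 \<rho> \<Longrightarrow> h z = exp (L z)"
    using holomorphic_logarithm_exists[OF convex_ball open_ball h, of 0] \<open>\<rho> > 0\<close>
    by (metis centre_in_ball)
  have ReL: "Re (L w) = ln (norm (h w))" if "w \<in> ball 0 \<rho>" for w
    using L(2)[OF that] by simp
  have ReL_le: "Re (L w) \<le> \<Lambda>" if "w \<in> ball 0 \<rho>" for w
    using bd[OF that] L(2)[OF that] by simp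
  \<comment> \<open>The summand 1 makes \<open>A\<close> positive and the bound
    \<open>Re (u w) < A\<close> strict, so that the next denominator has no zeros.\<close>
  define A where "A = \<Lambda> + 1 - Re (L 0)"
  have A: "A \<ge> 1" using ReL_le[of 0] \<open>\<rho> > 0\<close> by (auto simp: A_def)
  define u where "u = (\<lambda>w. L w - L 0)"
  have uhol: "u holomorphic_on ball 0 \<rho>" unfolding u_def by (intro holomorphic_intros L)
  have Reu: "Re (u w) < A" if "w \<in> ball 0 \<rho>" for w
    using ReL_le[OF that] by (auto simp: u_def A_def)
  \<comment> \<open>The Moebius map u / (2A - u) takes the half-plane Re u < A to the unit disc and
    fixes 0. The Schwarz lemma then gives |\<phi>| \<le> 1/2 on the half-size disc, which unwinds to
    |u| \<le> 2A.\<close>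
  define \<phi> where "\<phi> = (\<lambda>w. u w / (2 * of_real A - u w))"
  have nz: "2 * of_real A - u w \<noteq> 0" if "w \<in> ball 0 \<rho>" for w
  proof
    assume "2 * of_real A - u w = 0"
    then have "Re (2 * of_real A - u w) = 0" by simp
    then show False using Reu[OF that] A by simp
  qed
  have less1: "norm (\<phi> w) < 1" if "w \<in> ball 0 \<rho>" for w
  proof -
    have "A * Re (u w) < A * A" using Reu[OF that] A by (intro mult_strict_left_mono) auto
    then have "(norm (u w))\<^sup>2 < (norm (2 * of_real A - u w))\<^sup>2"
      by (simp add: cmod_power2) (simp add: power2_eq_square algebra_simps)
    then have "norm (u w) < norm (2 * of_real A - u w)" by (rule power_less_imp_less_base) simp
    then show ?thesis using nz[OF that] by (simp add: \<phi>_def norm_divide)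
  qed
  have sch: "norm (\<phi> w) \<le> norm w / \<rho>" if "w \<in> ball 0 \<rho>" for w
  proof -
    have "norm ((\<lambda>x. \<phi> (of_real \<rho> * x)) (w / of_real \<rho>)) \<le> norm (w / of_real \<rho>)"
    proof (rule Schwarz_Lemma(1))
      have "\<phi> holomorphic_on ball 0 \<rho>" unfolding \<phi>_def by (intro holomorphic_intros uhol nz)
      moreover have "(\<lambda>x. of_real \<rho> * x) holomorphic_on ball 0 1" by (intro holomorphic_intros)
      moreover have "(\<lambda>x. of_real \<rho> * x) ` ball 0 1 \<subseteq> (ball 0 \<rho> :: complex set)"
        using \<open>\<rho> > 0\<close> by (auto simp: norm_mult)
      ultimately have "(\<phi> \<circ> (\<lambda>x. of_real \<rho> * x)) holomorphic_on ball 0 1"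
        using holomorphic_on_compose_gen by blast
      then show "(\<lambda>x. \<phi> (of_real \<rho> * x)) holomorphic_on ball 0 1" by (simp add: o_def)
      show "\<phi> (of_real \<rho> * 0) = 0" by (simp add: \<phi>_def u_def)
      show "norm (\<phi> (of_real \<rho> * x)) < 1" if "norm x < 1" for x
        using that \<open>\<rho> > 0\<close> by (intro less1) (auto simp: norm_mult)
    qed (use that \<open>\<rho> > 0\<close> in \<open>auto simp: norm_divide\<close>)
    then show ?thesis using \<open>\<rho> > 0\<close> by (auto simp: norm_divide)
  qed
  have u_bd: "norm (u w) \<le> 2 * A" if "norm w \<le> \<rho> / 2" for w
  proof -
    have w: "w \<in> ball 0 \<rho>" using that \<open>\<rho> > 0\<close> by auto
    have "norm w / \<rho> \<le> 1 / 2" using that \<open>\<rho> > 0\<close> by (simp add: field_simps)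
    then have "norm (\<phi> w) \<le> 1 / 2" using sch[OF w] by linarith
    then have "norm (u w) \<le> norm (2 * of_real A - u w) / 2"
      using nz[OF w] by (simp add: \<phi>_def norm_divide field_simps)
    also have "norm (2 * of_real A - u w) \<le> 2 * A + norm (u w)"
      using norm_triangle_ineq4[of "2 * of_real A" "u w"] A by (simp add: norm_mult)
    finally show ?thesis by simp
  qed
  have zb: "z \<in> ball 0 \<rho>" using z \<open>\<rho> > 0\<close> by auto
  have sub: "cball z (\<rho> / 4) \<subseteq> cball 0 (\<rho> / 2)"
  proof
    fix x assume "x \<in> cball z (\<rho> / 4)"
    then have "norm (x - z) \<le> \<rho> / 4" by (simp add: dist_norm norm_minus_commute)
    then have "norm x \<le> \<rho> / 2" using z norm_triangle_ineq[of "x - z" z] by simp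
    then show "x \<in> cball 0 (\<rho> / 2)" by simp
  qed
  also have "\<dots> \<subseteq> ball 0 \<rho>" using \<open>\<rho> > 0\<close> by auto
  finally have sub2: "cball z (\<rho> / 4) \<subseteq> ball 0 \<rho>" .
  \<comment> \<open>The circle of radius \<rho>/4 about \<open>z\<close> stays where |u| \<le> 2A;
    hence 2A / (\<rho>/4), the source of the factor 8.\<close>
  have "norm ((deriv ^^ 1) u z) \<le> fact 1 * (2 * A) / (\<rho> / 4) ^ 1"
  proof (rule Cauchy_inequality)
    show "u holomorphic_on ball z (\<rho> / 4)"
      by (rule holomorphic_on_subset[OF uhol]) (use sub2 in auto)
    show "continuous_on (cball z (\<rho> / 4)) u"
      by (rule continuous_on_subset[OF holomorphic_on_imp_continuous_on[OF uhol] sub2])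
    fix x assume "norm (z - x) = \<rho> / 4"
    then have "x \<in> cball z (\<rho> / 4)" by (simp add: dist_norm)
    then show "norm (u x) \<le> 2 * A" using sub by (intro u_bd) auto
  qed (use \<open>\<rho> > 0\<close> in auto)
  then have "norm (deriv u z) \<le> 8 * A / \<rho>" by simp
  moreover have "deriv u z = deriv h z / h z"
  proof -
    have dL: "(L has_field_derivative deriv L z) (at z)"
      using L(1) zb by (auto intro: holomorphic_derivI)
    have "deriv u z = deriv L z" unfolding u_def
      by (rule DERIV_imp_deriv) (auto intro!: derivative_eq_intros dL)
    moreover have "((\<lambda>w. exp (L w)) has_field_derivative exp (L z) * deriv L z) (at z)"
      by (auto intro!: derivative_eq_intros dL)
    then have "(h has_field_derivative exp (L z) * deriv L z) (at z)"
      by (rule has_field_derivative_transform_within_open[of _ _ _ "ball 0 \<rho>"]) (use zb L in auto)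
    then have "deriv h z = h z * deriv L z" using L(2)[OF zb] DERIV_imp_deriv by fastforce
    ultimately show ?thesis using h(2)[OF zb] by simp
  qed
  ultimately show ?thesis using ReL[of 0] \<open>\<rho> > 0\<close> by (simp add: A_def)
qed

lemma entire_zeros_finite:
  assumes "f holomorphic_on UNIV" "\<not> f constant_on UNIV"
  shows "finite ({a. f a = (0::complex)} \<inter> cball 0 r)"
proof -
  have "finite {z \<in> cball 0 r. f z = 0}"
    by (rule holomorphic_compact_finite_zeros[of f UNIV]) (use assms in auto)
  then show ?thesis by (rule rev_finite_subset) auto
qed

text \<open>Dividing out only the zeros in \<open>cball 0 \<rho>\<close> and comparing on the circle of radius \<open>3 * \<rho>\<close>,
  where each factor \<open>z - a\<close> is at least twice \<open>a\<close> in modulus, bounds the number of zeros and the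
  logarithmic derivative of the zero-free part at once; it replaces Jensen's formula and the
  Hadamard factorization.\<close>

lemma log_deriv_zeros_approx:
  fixes f :: "complex \<Rightarrow> complex"
  assumes f: "f holomorphic_on UNIV" "\<not> f constant_on UNIV"
  defines "Z \<equiv> {a. f a = 0}"
  obtains D where
    "\<And>\<rho> M. \<rho> \<ge> 1 \<Longrightarrow> (\<And>z. norm z = 3 * \<rho> \<Longrightarrow> norm (f z) \<le> exp M) \<Longrightarrow>
       (\<Sum>a\<in>Z \<inter> cball 0 \<rho>. real (nat (zorder f a))) \<le> 2 * M + D"
    "\<And>\<rho> M z. \<rho> \<ge> 1 \<Longrightarrow> (\<And>z. norm z = 3 * \<rho> \<Longrightarrow> norm (f z) \<le> exp M) \<Longrightarrow>
       norm z \<le> \<rho> / 4 \<Longrightarrow> f z \<noteq> 0 \<Longrightarrow>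
       norm (deriv f z / f z - (\<Sum>a\<in>Z \<inter> cball 0 \<rho>. of_nat (nat (zorder f a)) / (z - a)))
         \<le> 8 * (M + D) / \<rho>"
proof -
  define m where "m = (\<lambda>a. nat (zorder f a))"
  obtain w0 where w0: "f w0 \<noteq> 0" using f(2) by (auto simp: constant_on_def)
  \<comment> \<open>\<open>f 0\<close> may vanish, so the value of \<open>g\<close> at 0 replaces it
    as normalization; \<open>c\<close> and \<open>D\<close> depend on \<open>f\<close> alone and not
    on \<rho>.\<close>
  obtain g where g: "g holomorphic_on UNIV" "g 0 \<noteq> 0" "\<And>z. f z = z ^ m 0 * g z"
    using entire_factor_zero[OF f(1) w0, of 0] unfolding m_def by auto
  define c where "c = norm (g 0)"
  have c: "c > 0" using g by (simp add: c_def)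
  define D where "D = 1 + 2 * \<bar>ln c\<bar> + m 0"
  have main: "(\<Sum>a\<in>Z \<inter> cball 0 \<rho>. real (m a)) \<le> 2 * M + D \<and>
     (\<forall>z. norm z \<le> \<rho> / 4 \<longrightarrow> f z \<noteq> 0 \<longrightarrow>
       norm (deriv f z / f z - (\<Sum>a\<in>Z \<inter> cball 0 \<rho>. of_nat (m a) / (z - a))) \<le> 8 * (M + D) / \<rho>)"
    if \<rho>: "\<rho> \<ge> 1" and M: "\<And>z. norm z = 3 * \<rho> \<Longrightarrow> norm (f z) \<le> exp M" for \<rho> M
  proof -
    define A where "A = Z \<inter> cball 0 \<rho>"
    have finA: "finite A" unfolding A_def Z_def by (rule entire_zeros_finite[OF f])
    define B where "B = A - {0}"
    have finB: "finite B" using finA by (simp add: B_def)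
    obtain h where h: "h holomorphic_on UNIV" "\<And>a. a \<in> A \<Longrightarrow> h a \<noteq> 0"
      and fh: "\<And>z. f z = (\<Prod>a\<in>A. (z - a) ^ m a) * h z"
      using entire_factor_zeros[OF f(1) w0 finA] unfolding m_def by metis
    have split: "f z = z ^ m 0 * (\<Prod>a\<in>B. (z - a) ^ m a) * h z" for z
    proof (cases "0 \<in> A")
      case True
      then show ?thesis using fh[of z] finA by (simp add: B_def prod.remove)
    next
      case False
      then have "f 0 \<noteq> 0" using \<rho> by (auto simp: A_def Z_def)
      then have "m 0 = 0" using g(3)[of 0] by (cases "m 0") auto
      then show ?thesis using fh[of z] False by (simp add: B_def)
    qed
    define P where "P = (\<lambda>z::complex. \<Prod>a\<in>B. (z - a) ^ m a)"
    define K where "K = (\<Prod>a\<in>B. (- a) ^ m a)"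
    have K0: "K \<noteq> 0" using finB by (auto simp: K_def B_def)
    \<comment> \<open>Since \<open>P z / K\<close> is the product of the (1 - z/a)^(m a) over the
      nonzero zeros, \<open>H\<close> is \<open>g\<close> divided by this product. This scaling
      fixes |H(0)| = \<open>c\<close> for every \<rho>.\<close>
    define H where "H = (\<lambda>z. h z * K)"
    have Phol: "P holomorphic_on UNIV" unfolding P_def by (intro holomorphic_intros)
    have Hhol: "H holomorphic_on UNIV" unfolding H_def by (intro holomorphic_intros h)
    have geq: "g z = P z * h z" if "z \<noteq> 0" for z
      using that g(3)[of z] split[of z] by (simp add: P_def)
    \<comment> \<open>The factorization determines \<open>g\<close> only off 0, where the power of
      \<open>z\<close> can be cancelled; the value at 0 follows by continuity.\<close>
    have "g 0 = P 0 * h 0"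
    proof (rule tendsto_unique[of "at 0"])
      show "(g \<longlongrightarrow> g 0) (at 0)"
        using g(1) by (metis UNIV_I at_within_open continuous_on holomorphic_on_imp_continuous_on open_UNIV)
      have "((\<lambda>z. P z * h z) \<longlongrightarrow> P 0 * h 0) (at 0)"
        using Phol h(1)
        by (intro tendsto_mult) (metis UNIV_I at_within_open continuous_on holomorphic_on_imp_continuous_on open_UNIV)+
      then show "(g \<longlongrightarrow> P 0 * h 0) (at 0)"
        by (rule Lim_transform_eventually) (auto simp: eventually_at_filter geq)
    qed simp
    then have H0: "norm (H 0) = c" by (simp add: H_def c_def P_def K_def mult.commute)
    define n where "n = (\<Sum>a\<in>B. m a)"
    have bdry: "norm (H z) \<le> exp M / 2 ^ n" if z: "norm z = 3 * \<rho>" for z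
    proof -
      have "2 ^ n * norm K = (\<Prod>a\<in>B. (2 * norm a) ^ m a)"
        by (simp add: n_def K_def power_sum prod_norm power_mult_distrib prod.distrib norm_power
              flip: prod_norm)
      also have "\<dots> \<le> (\<Prod>a\<in>B. norm ((z - a) ^ m a))"
      proof (rule prod_mono, intro conjI)
        fix a assume "a \<in> B"
        then have a: "norm a \<le> \<rho>" by (auto simp: B_def A_def)
        have "2 * norm a \<le> norm (z - a)"
          using z a norm_triangle_ineq2[of z a] by linarith
        then show "(2 * norm a) ^ m a \<le> norm ((z - a) ^ m a)"
          unfolding norm_power by (rule power_mono) simp
      qed auto
      also have "\<dots> = norm (P z)" by (simp add: P_def prod_norm)
      also have "norm (P z) \<le> norm z ^ m 0 * norm (P z)"
        using mult_right_mono[OF one_le_power[of "norm z" "m 0"], of "norm (P z)"] z \<rho> by simp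
      finally have "2 ^ n * norm K * norm (h z) \<le> norm z ^ m 0 * norm (P z) * norm (h z)"
        by (rule mult_right_mono) simp
      also have "\<dots> = norm (f z)" using split[of z] by (simp add: P_def norm_mult norm_power)
      also have "\<dots> \<le> exp M" by (rule M[OF z])
      finally show ?thesis by (simp add: H_def norm_mult field_simps)
    qed
    have Hbd: "norm (H z) \<le> exp M / 2 ^ n" if "norm z < 3 * \<rho>" for z
    proof (rule maximum_modulus_frontier[where S = "ball 0 (3 * \<rho>)" and f = H])
      show "H holomorphic_on interior (ball 0 (3 * \<rho>))"
        by (rule holomorphic_on_subset[OF Hhol]) auto
      show "continuous_on (closure (ball 0 (3 * \<rho>))) H"
        using Hhol holomorphic_on_imp_continuous_on continuous_on_subset by blast
    qed (use that \<rho> bdry in \<open>auto simp: frontier_ball\<close>)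
    \<comment> \<open>Every zero counted in \<open>n\<close> gains a factor 2 on the circle of
      radius 3\<rho>, so the value at the center bounds their number: n ln 2 \<le> M - ln c. The
      estimate ln 2 \<ge> 1/2 turns this into the factor 2 in front of \<open>M\<close>.\<close>
    have "c * 2 ^ n \<le> exp M" using Hbd[of 0] H0 \<rho> by (simp add: field_simps)
    then have "ln (c * 2 ^ n) \<le> ln (exp M)" using c by (subst ln_le_cancel_iff) auto
    then have n_le: "ln c + n * ln 2 \<le> M" using c by (simp add: ln_mult ln_realpow)
    have "real n / 2 \<le> n * ln 2" using ln2_ge_two_thirds mult_left_mono[of "1/2" "ln 2" "real n"] by simp
    then have n2: "real n \<le> 2 * M + 2 * \<bar>ln c\<bar>" using n_le by linarith
    have "(\<Sum>a\<in>A. real (m a)) \<le> (\<Sum>a\<in>insert 0 B. real (m a))"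
      using finB by (intro sum_mono2) (auto simp: B_def)
    also have "\<dots> = m 0 + real n"
      using finB by (subst sum.insert) (auto simp: B_def n_def)
    finally have one: "(\<Sum>a\<in>A. real (m a)) \<le> 2 * M + D" using n2 by (simp add: D_def)
    have two: "norm (deriv f z / f z - (\<Sum>a\<in>A. of_nat (m a) / (z - a))) \<le> 8 * (M + D) / \<rho>"
      if z: "norm z \<le> \<rho> / 4" "f z \<noteq> 0" for z
    proof -
      have hz: "h z \<noteq> 0" using z fh by auto
      have zA: "z \<notin> A" using z by (auto simp: A_def Z_def)
      have dh: "h field_differentiable at z"
        using h(1) by (simp add: holomorphic_on_imp_differentiable_at)
      have "(\<lambda>w. \<Prod>a\<in>A. (w - a) ^ m a) holomorphic_on UNIV" by (intro holomorphic_intros)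
      then have dP: "(\<lambda>w. \<Prod>a\<in>A. (w - a) ^ m a) field_differentiable at z"
        by (simp add: holomorphic_on_imp_differentiable_at)
      have feq: "f = (\<lambda>w. (\<Prod>a\<in>A. (w - a) ^ m a) * h w)" using fh by blast
      have "deriv (\<lambda>w. (\<Prod>a\<in>A. (w - a) ^ m a) * h w) z / ((\<Prod>a\<in>A. (z - a) ^ m a) * h z) =
          deriv (\<lambda>w. \<Prod>a\<in>A. (w - a) ^ m a) z / (\<Prod>a\<in>A. (z - a) ^ m a) + deriv h z / h z"
        using zA finA hz by (intro deriv_over_self_mult dh dP) auto
      then have "deriv f z / f z = deriv (\<lambda>w. \<Prod>a\<in>A. (w - a) ^ m a) z / (\<Prod>a\<in>A. (z - a) ^ m a) + deriv h z / h z"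
        using feq by metis
      also have "deriv h z / h z = deriv H z / H z"
        using dh K0 by (simp add: H_def)
      finally have "deriv f z / f z - (\<Sum>a\<in>A. of_nat (m a) / (z - a)) = deriv H z / H z"
        using deriv_over_self_prod[OF finA zA, of m] by simp
      also have "norm \<dots> \<le> 8 * (M + 1 - ln (norm (H 0))) / \<rho>"
      proof (rule deriv_over_self_bound)
        show "H holomorphic_on ball 0 \<rho>" using Hhol holomorphic_on_subset by blast
        show "H w \<noteq> 0" if "w \<in> ball 0 \<rho>" for w
        proof (cases "w \<in> A")
          case False
          then have "f w \<noteq> 0" using that by (auto simp: A_def Z_def)
          then show ?thesis using K0 fh[of w] by (auto simp: H_def)
        qed (use h K0 in \<open>auto simp: H_def\<close>)
        show "norm (H w) \<le> exp M" if "w \<in> ball 0 \<rho>" for w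
        proof -
          have "norm (H w) \<le> exp M / 2 ^ n" using that \<rho> by (intro Hbd) auto
          also have "\<dots> \<le> exp M / 1" by (intro divide_left_mono) auto
          finally show ?thesis by simp
        qed
      qed (use \<rho> z in auto)
      also have "\<dots> \<le> 8 * (M + D) / \<rho>"
        using \<rho> H0 by (intro divide_right_mono) (auto simp: D_def)
      finally show ?thesis .
    qed
    show ?thesis using one two unfolding A_def by blast
  qed
  show ?thesis using that[of D] main unfolding m_def by blast
qed

lemma entire_order_zero_growth:
  assumes f: "f holomorphic_on UNIV" and ord: "entire_order f = 0" and "\<delta> > 0"
  shows "eventually (\<lambda>r. \<forall>z. norm z \<le> r \<longrightarrow> norm (f z) \<le> exp (r powr \<delta>)) at_top"
proof -
  have "Limsup at_top (\<lambda>r. ereal (ln (ln (max_modulus r f)) / ln r)) < ereal \<delta>"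
    using ord \<open>\<delta> > 0\<close> by (simp add: entire_order_def)
  then have "eventually (\<lambda>r. ereal (ln (ln (max_modulus r f)) / ln r) < ereal \<delta>) at_top"
    by (rule Limsup_lessD)
  moreover have "eventually (\<lambda>r::real. r > 1) at_top" by (rule eventually_gt_at_top)
  ultimately show ?thesis
  proof eventually_elim
    case (elim r)
    show ?case
    proof (intro allI impI)
      fix z :: complex assume z: "norm z \<le> r"
      have "compact (f ` cball 0 r)"
        using f by (intro compact_continuous_image) (auto intro: holomorphic_on_imp_continuous_on holomorphic_on_subset)
      then have "bdd_above ((\<lambda>z. norm (f z)) ` cball 0 r)"
        by (metis bdd_above_norm compact_imp_bounded image_image)
      then have fz: "norm (f z) \<le> max_modulus r f"
        unfolding max_modulus_def using z by (intro cSUP_upper) auto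
      show "norm (f z) \<le> exp (r powr \<delta>)"
      proof (cases "max_modulus r f > 1")
        case True
        then have l: "ln (max_modulus r f) > 0" by simp
        have "ln (ln (max_modulus r f)) < \<delta> * ln r" using elim by (simp add: field_simps)
        then have "exp (ln (ln (max_modulus r f))) < exp (\<delta> * ln r)" by simp
        then have "ln (max_modulus r f) < r powr \<delta>" using l elim by (simp add: powr_def)
        then have "exp (ln (max_modulus r f)) < exp (r powr \<delta>)" by simp
        then show ?thesis using fz True by simp
      next
        case False
        \<comment> \<open>Here the iterated logarithm carries no information about the maximum
          modulus, but a bound by 1 suffices.\<close>
        then have "norm (f z) \<le> 1" using fz by simp
        also have "1 \<le> exp (r powr \<delta>)" by simp
        finally show ?thesis .
      qed
    qed
  qed
qed
subsection \<open>Radii at which the zeros are far away\<close>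

text \<open>If at every large dyadic scale a fixed proportion of the mass \<open>m\<close> were
  comparable to that scale, the mass would gain a fixed factor at each doubling, against the
  subgeometric growth. The quantification over \<rho> expresses an infinite sum over all of
  \<open>Z\<close> by its truncations. The point \<open>a0\<close> guarantees that the total
  \<open>N\<close> is eventually positive.\<close>

lemma concentration_radius:
  fixes Z :: "'a::real_normed_vector set" and m :: "'a \<Rightarrow> real"
  assumes m: "\<And>a. 0 \<le> m a" and fin: "\<And>r. finite (Z \<inter> cball 0 r)"
    and growth: "\<And>\<theta>. \<theta> > 1 \<Longrightarrow> \<exists>c. \<forall>i. (\<Sum>a\<in>Z \<inter> cball 0 (2 ^ i). m a) \<le> c * \<theta> ^ i"
    and a0: "a0 \<in> Z" "m a0 > 0" and "\<epsilon> > 0"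
  shows "\<exists>i\<ge>i0. (\<Sum>a\<in>Z \<inter> cball 0 (2 ^ i). m a) > 0 \<and>
     (\<forall>\<rho>. (\<Sum>a\<in>Z \<inter> cball 0 \<rho>. m a * min (norm a / 2 ^ i) (2 ^ i / norm a))
        \<le> \<epsilon> * (\<Sum>a\<in>Z \<inter> cball 0 (2 ^ i). m a))"
proof (rule ccontr)
  assume neg: "\<not> ?thesis"
  define N where "N = (\<lambda>i. \<Sum>a\<in>Z \<inter> cball 0 (2 ^ i). m a)"
  define B where "B = (\<lambda>i. \<Sum>a\<in>Z \<inter> cball 0 (2 ^ i). m a * (norm a / 2 ^ i))"
  \<comment> \<open>\<open>B\<close> takes the branch |a| / 2^i of the minimum for points inside the
    disc, \<open>C\<close> the branch 2^i / |a| for those outside. As an infinite sum,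
    \<open>C\<close> majorizes the outer part of all truncations at once.\<close>
  define C where "C = (\<lambda>i. infsum (\<lambda>a. m a * (2 ^ i / norm a)) (Z - cball 0 (2 ^ i)))"
  define S where "S = (\<lambda>i. Z \<inter> (cball 0 (2 ^ Suc i) - cball 0 (2 ^ i)))"
  have mono: "cball 0 (2 ^ i) \<subseteq> (cball 0 (2 ^ Suc i) :: 'a set)" for i :: nat
    by (intro subset_cball power_increasing) auto
  have finS: "finite (S i)" for i
    unfolding S_def by (rule finite_subset[OF _ fin[of "2 ^ Suc i"]]) auto
  \<comment> \<open>Peeling off the innermost shell costs at most c \<theta>^(i+1), and the
    remainder is half of the same sum at the next scale. The constant 6 reproduces itself: c\<theta>
    + 3c\<theta> = 4c\<theta> \<le> 6c for \<theta> \<le> 3/2.\<close>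
  have tail: "(\<Sum>a\<in>Z \<inter> (cball 0 (2 ^ (i + k)) - cball 0 (2 ^ i)). m a * (2 ^ i / norm a)) \<le> 6 * c * \<theta> ^ i"
    if \<theta>: "\<theta> \<ge> 1" "\<theta> \<le> 3 / 2" and c: "\<And>j. N j \<le> c * \<theta> ^ j" for \<theta> c i k
  proof (induction k arbitrary: i)
    case 0
    have "0 \<le> N 0" unfolding N_def by (intro sum_nonneg m)
    then have "0 \<le> c" using c[of 0] by simp
    then show ?case using \<theta> by simp
  next
    case (Suc k)
    have "0 \<le> N 0" unfolding N_def by (intro sum_nonneg m)
    then have c0: "0 \<le> c" using c[of 0] by simp
    let ?T = "Z \<inter> (cball 0 (2 ^ (Suc i + k)) - cball 0 (2 ^ Suc i))"
    have finT: "finite ?T" by (rule finite_subset[OF _ fin[of "2 ^ (Suc i + k)"]]) auto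
    have "cball 0 (2 ^ Suc i) \<subseteq> (cball 0 (2 ^ (Suc i + k)) :: 'a set)"
      by (intro subset_cball power_increasing) auto
    with mono[of i] have "Z \<inter> (cball 0 (2 ^ (i + Suc k)) - cball 0 (2 ^ i)) = S i \<union> ?T"
      unfolding S_def add_Suc_right add_Suc by blast
    moreover have "S i \<inter> ?T = {}" by (auto simp: S_def)
    ultimately have "(\<Sum>a\<in>Z \<inter> (cball 0 (2 ^ (i + Suc k)) - cball 0 (2 ^ i)). m a * (2 ^ i / norm a)) =
      (\<Sum>a\<in>S i. m a * (2 ^ i / norm a)) + (\<Sum>a\<in>?T. m a * (2 ^ i / norm a))"
      using finS finT by (simp add: sum.union_disjoint)
    also have "(\<Sum>a\<in>S i. m a * (2 ^ i / norm a)) \<le> (\<Sum>a\<in>S i. m a)"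
    proof (rule sum_mono)
      fix a assume "a \<in> S i"
      then have "2 ^ i / norm a \<le> 1" by (auto simp: S_def divide_le_eq)
      then show "m a * (2 ^ i / norm a) \<le> m a" using m[of a] mult_left_le by blast
    qed
    also have "(\<Sum>a\<in>S i. m a) \<le> N (Suc i)"
      unfolding N_def by (rule sum_mono2) (use fin m in \<open>auto simp: S_def\<close>)
    also have "\<dots> \<le> c * \<theta> ^ Suc i" by (rule c)
    also have "(\<Sum>a\<in>?T. m a * (2 ^ i / norm a)) = (\<Sum>a\<in>?T. m a * (2 ^ Suc i / norm a)) / 2"
      by (simp add: sum_divide_distrib)
    also have "\<dots> \<le> 6 * c * \<theta> ^ Suc i / 2"
      by (intro divide_right_mono Suc.IH) simp
    also have "c * \<theta> ^ Suc i + 6 * c * \<theta> ^ Suc i / 2 = (4 * (c * \<theta> ^ i)) * \<theta>" by simp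
    also have "\<dots> \<le> (4 * (c * \<theta> ^ i)) * (3 / 2)"
      using \<theta> c0 by (intro mult_left_mono) auto
    finally show ?case by simp
  qed
  have fin_tail: "sum (\<lambda>a. m a * (2 ^ i / norm a)) F \<le> 6 * c * \<theta> ^ i"
    if \<theta>: "\<theta> \<ge> 1" "\<theta> \<le> 3 / 2" and c: "\<And>j. N j \<le> c * \<theta> ^ j"
      and F: "finite F" "F \<subseteq> Z - cball 0 (2 ^ i)" for \<theta> c i F
  proof -
    obtain k where k: "Max (insert 0 (norm ` F)) < 2 ^ k"
      using real_arch_pow[of 2] by auto
    have "norm a \<le> 2 ^ (i + k)" if "a \<in> F" for a
    proof -
      have "norm a \<le> Max (insert 0 (norm ` F))" using F that by (intro Max_ge) auto
      also have "\<dots> \<le> 2 ^ k" using k by simp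
      also have "(2::real) ^ k \<le> 2 ^ (i + k)" by (intro power_increasing) auto
      finally show ?thesis .
    qed
    then have "F \<subseteq> Z \<inter> (cball 0 (2 ^ (i + k)) - cball 0 (2 ^ i))" using F by auto
    then have "sum (\<lambda>a. m a * (2 ^ i / norm a)) F \<le>
        (\<Sum>a\<in>Z \<inter> (cball 0 (2 ^ (i + k)) - cball 0 (2 ^ i)). m a * (2 ^ i / norm a))"
      using m by (intro sum_mono2) (auto intro: finite_subset[OF _ fin[of "2 ^ (i + k)"]])
    also have "\<dots> \<le> 6 * c * \<theta> ^ i" by (rule tail[OF \<theta> c])
    finally show ?thesis .
  qed
  have summ: "(\<lambda>a. m a * (2 ^ i / norm a)) summable_on (Z - cball 0 (2 ^ i))" for i
  proof -
    obtain c where "\<And>j. N j \<le> c * (3 / 2) ^ j" using growth[of "3/2"] unfolding N_def by auto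
    then show ?thesis
      using m fin_tail[of "3/2" c]
      by (intro nonneg_bdd_above_summable_on bdd_aboveI2[where M = "6 * c * (3/2) ^ i"]) auto
  qed
  have C_le: "C i \<le> 6 * c * \<theta> ^ i"
    if \<theta>: "\<theta> \<ge> 1" "\<theta> \<le> 3 / 2" and c: "\<And>j. N j \<le> c * \<theta> ^ j" for \<theta> c i
    unfolding C_def by (rule infsum_le_finite_sums[OF summ]) (rule fin_tail[OF that])
  have C0: "C i \<ge> 0" for i unfolding C_def using m by (intro infsum_nonneg) auto
  have B0: "B i \<ge> 0" for i unfolding B_def using m by (intro sum_nonneg) auto
  have N0: "N i \<ge> 0" for i unfolding N_def using m by (intro sum_nonneg) auto
  have BN: "B i \<le> N i" for i
    unfolding B_def N_def
  proof (rule sum_mono)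
    fix a assume "a \<in> Z \<inter> cball 0 (2 ^ i)"
    then have "norm a / 2 ^ i \<le> 1" by (auto simp: divide_le_eq)
    then show "m a * (norm a / 2 ^ i) \<le> m a" using m[of a] mult_left_le by blast
  qed
  \<comment> \<open>Passing from \<open>2 ^ i\<close> to \<open>2 ^ Suc i\<close> increases \<open>N - B\<close> by at least \<open>B / 2\<close> and
    \<open>2 * N + C\<close> by at least \<open>C\<close>. If \<open>B + C\<close> always exceeded \<open>\<epsilon> * N\<close>, then \<open>V\<close> would grow
    geometrically, against the growth hypothesis.\<close>
  define V where "V = (\<lambda>i. 2 * (N i - B i) + 2 * N i + C i)"
  have step: "V (Suc i) \<ge> V i + (B i + C i)" for i
  proof -
    have un: "Z \<inter> cball 0 (2 ^ Suc i) = (Z \<inter> cball 0 (2 ^ i)) \<union> S i"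
      using mono[of i] unfolding S_def by blast
    have dj: "(Z \<inter> cball 0 (2 ^ i)) \<inter> S i = {}" by (auto simp: S_def)
    define d where "d = (\<Sum>a\<in>S i. m a)"
    define s where "s = (\<Sum>a\<in>S i. m a * (norm a / 2 ^ Suc i))"
    define t where "t = (\<Sum>a\<in>S i. m a * (2 ^ i / norm a))"
    have "N (Suc i) = N i + d"
      unfolding N_def d_def un using fin finS dj by (intro sum.union_disjoint) auto
    moreover have "B (Suc i) = B i / 2 + s"
    proof -
      have "B (Suc i) = (\<Sum>a\<in>Z \<inter> cball 0 (2 ^ i). m a * (norm a / 2 ^ Suc i)) + s"
        unfolding B_def s_def un using fin finS dj by (intro sum.union_disjoint) auto
      then show ?thesis by (simp add: B_def sum_divide_distrib mult.commute[of 2])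
    qed
    moreover have "C i = t + C (Suc i) / 2"
    proof -
      have un2: "Z - cball 0 (2 ^ i) = S i \<union> (Z - cball 0 (2 ^ Suc i))"
        using mono[of i] unfolding S_def by blast
      have eq: "(\<lambda>a. m a * (2 ^ Suc i / norm a) * (1 / 2)) = (\<lambda>a. m a * (2 ^ i / norm a))"
        by (auto simp: field_simps)
      have "(\<lambda>a. m a * (2 ^ i / norm a)) summable_on (Z - cball 0 (2 ^ Suc i))"
        by (rule summable_on_subset_banach[OF summ[of i]]) (use un2 in auto)
      then have "C i = infsum (\<lambda>a. m a * (2 ^ i / norm a)) (S i) +
          infsum (\<lambda>a. m a * (2 ^ i / norm a)) (Z - cball 0 (2 ^ Suc i))"
        unfolding C_def un2 using finS by (intro infsum_Un_disjoint) (auto simp: S_def)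
      also have "infsum (\<lambda>a. m a * (2 ^ i / norm a)) (Z - cball 0 (2 ^ Suc i)) = C (Suc i) / 2"
        unfolding C_def eq[symmetric] infsum_cmult_left' by simp
      finally show ?thesis using finS by (simp add: t_def)
    qed
    moreover have "s \<le> d"
      unfolding s_def d_def
    proof (rule sum_mono)
      fix a assume "a \<in> S i"
      then have "norm a / 2 ^ Suc i \<le> 1" by (auto simp: S_def divide_le_eq)
      then show "m a * (norm a / 2 ^ Suc i) \<le> m a" using m[of a] mult_left_le by blast
    qed
    moreover have "t \<le> d"
      unfolding t_def d_def
    proof (rule sum_mono)
      fix a assume "a \<in> S i"
      then have "2 ^ i / norm a \<le> 1" by (auto simp: S_def divide_le_eq)
      then show "m a * (2 ^ i / norm a) \<le> m a" using m[of a] mult_left_le by blast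
    qed
    \<comment> \<open>With \<open>d\<close>, \<open>s\<close>, \<open>t\<close> the three sums over
      the new shell, the increment of \<open>V\<close> is B + C + 4d - 2s - 2t, and \<open>s\<close>
      and \<open>t\<close> are at most \<open>d\<close>.\<close>
    ultimately show ?thesis unfolding V_def by (simp add: field_simps)
  qed
  have K_le: "(\<Sum>a\<in>Z \<inter> cball 0 \<rho>. m a * min (norm a / 2 ^ i) (2 ^ i / norm a)) \<le> B i + C i" for \<rho> i
  proof -
    let ?g = "\<lambda>a. m a * min (norm a / 2 ^ i) (2 ^ i / norm a)"
    let ?F = "Z \<inter> cball 0 \<rho> - cball 0 (2 ^ i)"
    have finF: "finite ?F" using fin by auto
    have "sum ?g (Z \<inter> cball 0 \<rho>) \<le> sum ?g ((Z \<inter> cball 0 (2 ^ i)) \<union> ?F)"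
      using m fin finF by (intro sum_mono2) auto
    also have "\<dots> = sum ?g (Z \<inter> cball 0 (2 ^ i)) + sum ?g ?F"
      using fin finF by (intro sum.union_disjoint) auto
    also have "sum ?g (Z \<inter> cball 0 (2 ^ i)) \<le> B i"
      unfolding B_def using m by (intro sum_mono mult_left_mono) auto
    also have "sum ?g ?F \<le> (\<Sum>a\<in>?F. m a * (2 ^ i / norm a))"
      using m by (intro sum_mono mult_left_mono) auto
    also have "\<dots> \<le> C i"
      unfolding C_def using m finF by (intro finite_sum_le_infsum summ) auto
    finally show ?thesis by simp
  qed
  define \<epsilon>' where "\<epsilon>' = min \<epsilon> 1"
  have e: "\<epsilon>' > 0" "\<epsilon>' \<le> 1" "\<epsilon>' \<le> \<epsilon>" using \<open>\<epsilon> > 0\<close> by (auto simp: \<epsilon>'_def)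
  obtain i1 where i1: "norm a0 < 2 ^ i1" using real_arch_pow[of 2 "norm a0"] by auto
  define i2 where "i2 = max i0 i1"
  have Npos: "N i > 0" if "i \<ge> i2" for i
  proof -
    have "(2::real) ^ i1 \<le> 2 ^ i" using that by (intro power_increasing) (auto simp: i2_def)
    then have "norm a0 \<le> 2 ^ i" using i1 by linarith
    then have "a0 \<in> Z \<inter> cball 0 (2 ^ i)" using a0 by simp
    then have "m a0 \<le> N i" unfolding N_def using fin m by (intro member_le_sum) auto
    then show ?thesis using a0 by simp
  qed
  have big: "B i + C i > \<epsilon> * N i" if "i \<ge> i2" for i
  proof -
    have "i \<ge> i0" using that by (simp add: i2_def)
    with neg Npos[OF that] obtain \<rho> where
      "\<not> (\<Sum>a\<in>Z \<inter> cball 0 \<rho>. m a * min (norm a / 2 ^ i) (2 ^ i / norm a)) \<le> \<epsilon> * N i"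
      unfolding N_def by blast
    then show ?thesis using K_le[of i \<rho>] by linarith
  qed
  \<comment> \<open>The excess gives B + C \<ge> (\<epsilon>' N + C) / 2, which is at least
    (\<epsilon>'/8)(4N + C) because \<epsilon>' \<le> 1; and \<open>V\<close> is at most 4N +
    C.\<close>
  define \<eta> where "\<eta> = \<epsilon>' / 8"
  have eta: "\<eta> > 0" "\<eta> \<le> 1 / 8" using e by (auto simp: \<eta>_def)
  have V_le: "V i \<le> 4 * N i + C i" for i using B0[of i] by (simp add: V_def)
  have V_step: "V (Suc i) \<ge> (1 + \<eta>) * V i" if "i \<ge> i2" for i
  proof -
    have "\<epsilon>' * N i \<le> \<epsilon> * N i" using e N0 by (intro mult_right_mono) auto
    then have "B i + C i \<ge> \<epsilon>' * N i / 2 + C i / 2" using big[OF that] B0[of i] by (simp add: field_simps)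
    moreover have "\<epsilon>' * C i \<le> 1 * C i" using e C0 by (intro mult_right_mono) auto
    ultimately have "B i + C i \<ge> \<eta> * (4 * N i + C i)"
      using C0[of i] by (simp add: \<eta>_def field_simps)
    also have "\<eta> * (4 * N i + C i) \<ge> \<eta> * V i" using eta V_le by (intro mult_left_mono) auto
    finally show ?thesis using step[of i] by (simp add: field_simps)
  qed
  have V_ge: "V (i2 + n) \<ge> (1 + \<eta>) ^ n * V i2" for n
  proof (induction n)
    case (Suc n)
    have "(1 + \<eta>) ^ Suc n * V i2 \<le> (1 + \<eta>) * V (i2 + n)"
      using Suc eta by simp
    also have "\<dots> \<le> V (i2 + Suc n)" using V_step[of "i2 + n"] by simp
    finally show ?case .
  qed simp
  \<comment> \<open>A rate strictly between 1 and 1 + \<eta>: \<open>V\<close> grows at least like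
    (1 + \<eta>)^i yet is O(\<theta>^i).\<close>
  define \<theta> where "\<theta> = 1 + \<eta> / 2"
  have \<theta>: "\<theta> > 1" "\<theta> \<le> 3 / 2" using eta by (auto simp: \<theta>_def)
  obtain c where c: "\<And>j. N j \<le> c * \<theta> ^ j" using growth[OF \<theta>(1)] unfolding N_def by auto
  have up: "V i \<le> 10 * c * \<theta> ^ i" for i
  proof -
    have "C i \<le> 6 * c * \<theta> ^ i" using c \<theta> by (intro C_le) auto
    then show ?thesis using V_le[of i] c[of i] by linarith
  qed
  have "V i2 > 0" using Npos[of i2] BN[of i2] C0[of i2] by (simp add: V_def)
  have "((1 + \<eta>) / \<theta>) ^ n * V i2 \<le> 10 * c * \<theta> ^ i2" for n
  proof -
    have "(1 + \<eta>) ^ n * V i2 \<le> 10 * c * \<theta> ^ i2 * \<theta> ^ n"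
      using V_ge[of n] up[of "i2 + n"] by (simp add: power_add)
    then show ?thesis using \<theta> by (simp add: power_divide field_simps)
  qed
  moreover have "(1 + \<eta>) / \<theta> > 1" using eta by (simp add: \<theta>_def)
  then obtain n where "((1 + \<eta>) / \<theta>) ^ n > 10 * c * \<theta> ^ i2 / V i2"
    using real_arch_pow by blast
  ultimately show False using \<open>V i2 > 0\<close> by (simp add: field_simps not_less flip: not_le)
qed
subsection \<open>Area integrals in the complex plane\<close>

text \<open>Transports planar area to \<open>real^2\<close>, where invariance under orthogonal
  transformations can be used. Both measures agree on boxes, which determines them.\<close>

lemma lborel_complex_eq_distr_vec:
  "(lborel :: complex measure) =
     distr (lborel :: (real^2) measure) borel (\<lambda>v. of_real (v $ 1) + \<i> * of_real (v $ 2))"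
proof (rule lborel_eqI)
  let ?T = "\<lambda>v::real^2. of_real (v $ 1) + \<i> * of_real (v $ 2)"
  define T' where "T' = (\<lambda>z. \<chi> i. if i = (1::2) then Re z else Im z)"
  have T'_nth: "T' z $ 1 = Re z" "T' z $ 2 = Im z" for z by (simp_all add: T'_def)
  have [measurable]: "?T \<in> borel_measurable borel"
    by (intro borel_measurable_continuous_onI continuous_intros)
  fix l u :: complex
  assume le: "\<And>b. b \<in> Basis \<Longrightarrow> l \<bullet> b \<le> u \<bullet> b"
  have le': "Re l \<le> Re u" "Im l \<le> Im u" using le[of 1] le[of \<i>] by (auto simp: Basis_complex_def)
  have basis: "Basis = {axis 1 1, axis 2 (1::real) :: real^2}"
    by (auto simp: Basis_vec_def UNIV_2)
  have neq: "axis 1 1 \<noteq> (axis 2 1 :: real^2)" by (simp add: axis_eq_axis)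
  have "?T -` box l u = box (T' l) (T' u)"
    by (auto simp: mem_box_cart forall_2 in_box_complex_iff T'_nth)
  then have "emeasure (distr lborel borel ?T) (box l u) = emeasure lborel (box (T' l) (T' u))"
    by (simp add: emeasure_distr)
  also have "\<dots> = ennreal ((Re u - Re l) * (Im u - Im l))"
    using le' neq by (subst emeasure_lborel_box) (auto simp: basis inner_axis T'_nth)
  also have "\<dots> = (\<Prod>b\<in>Basis. (u - l) \<bullet> b)"
    by (simp add: Basis_complex_def)
  finally show "emeasure (distr lborel borel ?T) (box l u) = (\<Prod>b\<in>Basis. (u - l) \<bullet> b)" .
qed simp

text \<open>In real coordinates, multiplication by a unimodular number is a linear isometry, hence
  an orthogonal transformation, and these preserve area.\<close>

lemma lborel_distr_complex_rotation:
  assumes "norm c = 1"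
  shows "distr lborel borel (\<lambda>z. c * z) = (lborel :: complex measure)"
proof (rule lborel_eqI[symmetric])
  define T where "T = (\<lambda>v::real^2. of_real (v $ 1) + \<i> * of_real (v $ 2))"
  define T' where "T' = (\<lambda>z. \<chi> i. if i = (1::2) then Re z else Im z)"
  have TT': "T (T' z) = z" for z by (simp add: T_def T'_def complex_eq_iff)
  have T'T: "T' (T v) = v" for v by (simp add: T_def T'_def vec_eq_iff forall_2)
  have lT: "linear T" by (rule linearI) (simp_all add: T_def complex_eq_iff)
  have lT': "linear T'" by (rule linearI) (simp_all add: T'_def vec_eq_iff)
  have nT: "norm (T v) = norm v" for v
    by (simp add: T_def norm_complex_def norm_vec_def L2_set_def sum_2 UNIV_2)
  have [measurable]: "T \<in> borel_measurable borel"
    unfolding T_def by (intro borel_measurable_continuous_onI continuous_intros)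
  have mc[measurable]: "(\<lambda>z. c * z) \<in> borel_measurable borel"
    by (intro borel_measurable_continuous_onI continuous_intros)
  \<comment> \<open>The conjugate is the inverse of \<open>c\<close>: the preimage of a box under
    multiplication by \<open>c\<close> is its image under \<open>r\<close>.\<close>
  define r where "r = (\<lambda>v. T' (cnj c * T v))"
  have "linear (\<lambda>z. cnj c * z)" by (rule linearI) (simp_all add: algebra_simps)
  then have "linear (T' \<circ> (\<lambda>z. cnj c * z) \<circ> T)" using lT lT' by (intro linear_compose)
  then have "linear r" by (simp add: r_def o_def)
  moreover have "norm (r v) = norm v" for v
  proof -
    have "norm (r v) = norm (T (r v))" by (simp add: nT)
    also have "\<dots> = norm v" using assms by (simp add: r_def TT' norm_mult nT)
    finally show ?thesis .
  qed
  ultimately have orth: "orthogonal_transformation r" by (simp add: orthogonal_transformation)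
  have cc: "c * cnj c = 1" using assms by (simp add: complex_norm_square[symmetric])
  fix l u :: complex
  assume le: "\<And>b. b \<in> Basis \<Longrightarrow> l \<bullet> b \<le> u \<bullet> b"
  let ?A = "T -` box l u"
  have "T (r v) = cnj c * T v" for v by (simp add: r_def TT')
  have img: "T -` ((\<lambda>z. c * z) -` box l u) = r ` ?A"
  proof (intro equalityI subsetI)
    fix v assume v: "v \<in> T -` ((\<lambda>z. c * z) -` box l u)"
    have "r (T' (c * T v)) = v"
      using cc unfolding r_def TT' by (metis T'T mult.assoc mult.commute mult_1)
    moreover have "T' (c * T v) \<in> ?A" using v by (simp add: TT')
    ultimately show "v \<in> r ` ?A" by force
  next
    fix v assume "v \<in> r ` ?A"
    then obtain w where "w \<in> ?A" "v = r w" by auto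
    then show "v \<in> T -` ((\<lambda>z. c * z) -` box l u)"
      using cc by (simp add: r_def TT' mult.assoc[symmetric])
  qed
  have em: "emeasure lborel X = emeasure (lborel :: (real^2) measure) (T -` X)" if "X \<in> sets borel" for X
    using that by (subst lborel_complex_eq_distr_vec) (simp add: emeasure_distr T_def[symmetric])
  have fin: "emeasure lborel ?A < \<infinity>" using em[of "box l u"] emeasure_lborel_box_finite[of l u] by simp
  have Tb: "T -` X \<in> sets borel" if "X \<in> sets borel" for X
    using that measurable_sets[of T borel borel X] by simp
  have cb: "(\<lambda>z. c * z) -` box l u \<in> sets borel"
    using measurable_sets[OF mc, of "box l u"] by simp
  have Ab: "?A \<in> sets borel" by (rule Tb) simp
  have rAb: "r ` ?A \<in> sets borel" unfolding img[symmetric] by (rule Tb[OF cb])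
  have Al: "?A \<in> lmeasurable" using fin Ab by (simp add: fmeasurable_def)
  have "emeasure lborel (r ` ?A) = emeasure lebesgue (r ` ?A)" using rAb by simp
  also have "\<dots> = ennreal (measure lebesgue (r ` ?A))"
    using measurable_orthogonal_image[OF orth Al] by (simp add: emeasure_eq_measure2)
  also have "\<dots> = ennreal (measure lebesgue ?A)" by (simp add: measure_orthogonal_image[OF orth Al])
  also have "\<dots> = emeasure lebesgue ?A" using Al by (simp add: emeasure_eq_measure2)
  also have "\<dots> = emeasure lborel ?A" using Ab by simp
  finally have eq: "emeasure lborel (r ` ?A) = emeasure lborel ?A" .
  have "emeasure (distr lborel borel (\<lambda>z. c * z)) (box l u) = emeasure lborel ((\<lambda>z. c * z) -` box l u)"
    by (simp add: emeasure_distr)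
  also have "\<dots> = emeasure lborel (r ` ?A)"
    unfolding img[symmetric] by (rule em[OF cb])
  also have "\<dots> = emeasure lborel (box l u)" using eq em[of "box l u"] by simp
  also have "\<dots> = (\<Prod>b\<in>Basis. (u - l) \<bullet> b)" using le by simp
  finally show "emeasure (distr lborel borel (\<lambda>z. c * z)) (box l u) = (\<Prod>b\<in>Basis. (u - l) \<bullet> b)" .
qed simp

text \<open>A substitute for polar coordinates: rotating the argument does not change the area
  integral, so it may be averaged over all angles, and Fubini moves the average inside, where it
  vanishes for almost every \<open>z\<close>.\<close>

lemma integral_zero_if_circle_means_zero:
  fixes v :: "complex \<Rightarrow> real"
  assumes int: "integrable lborel (\<lambda>z. indicator (ball 0 R) z * v z)"
    and circ: "AE z in lborel. z \<in> ball 0 R \<longrightarrow>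
       integral\<^sup>L (restrict_space lborel {0..2 * pi}) (\<lambda>t. v (cis t * z)) = 0"
  shows "integral\<^sup>L lborel (\<lambda>z. indicator (ball 0 R) z * v z) = 0"
proof -
  define w where "w = (\<lambda>z. indicator (ball 0 R) z * v z)"
  define M where "M = restrict_space (lborel :: real measure) {0..2 * pi}"
  have wint: "integrable lborel w" using int by (simp add: w_def)
  have wm[measurable]: "w \<in> borel_measurable borel" using wint by simp
  interpret M: finite_measure M
    unfolding M_def by (rule finite_measureI) (simp add: emeasure_restrict_space space_restrict_space)
  interpret P: pair_sigma_finite M "lborel :: complex measure" by unfold_locales
  have rot: "(\<integral>z. h (w (cis t * z)) \<partial>lborel) = (\<integral>z. h (w z) \<partial>lborel)"
    if [measurable]: "h \<in> borel_measurable borel" for t and h :: "real \<Rightarrow> real"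
  proof -
    have [measurable]: "(\<lambda>z. cis t * z) \<in> borel_measurable borel"
      by (intro borel_measurable_continuous_onI continuous_intros)
    have "(\<integral>z. h (w z) \<partial>lborel) = (\<integral>z. h (w z) \<partial>distr lborel borel (\<lambda>z. cis t * z))"
      by (subst lborel_distr_complex_rotation) simp_all
    also have "\<dots> = (\<integral>z. h (w (cis t * z)) \<partial>lborel)" by (rule integral_distr) measurable
    finally show ?thesis by simp
  qed
  have roti: "integrable lborel (\<lambda>z. w (cis t * z))" for t
  proof -
    have [measurable]: "(\<lambda>z. cis t * z) \<in> borel_measurable borel"
      by (intro borel_measurable_continuous_onI continuous_intros)
    have "integrable (distr lborel borel (\<lambda>z. cis t * z)) w"
      using wint by (subst lborel_distr_complex_rotation) simp_all
    then show ?thesis by (subst (asm) integrable_distr_eq) measurable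
  qed
  have meas: "(\<lambda>(t, z). w (cis t * z)) \<in> borel_measurable (M \<Otimes>\<^sub>M lborel)"
  proof -
    have "(\<lambda>p :: real \<times> complex. cis (fst p) * snd p) \<in> borel_measurable borel"
      unfolding cis_conv_exp by (intro borel_measurable_continuous_onI continuous_intros)
    then have "(\<lambda>p :: real \<times> complex. w (cis (fst p) * snd p)) \<in> borel_measurable (borel \<Otimes>\<^sub>M borel)"
      unfolding borel_prod by measurable
    then have *: "(\<lambda>p :: real \<times> complex. w (cis (fst p) * snd p)) \<in> borel_measurable (lborel \<Otimes>\<^sub>M lborel)"
      by (simp cong: measurable_cong_sets sets_pair_measure_cong)
    have "(\<lambda>p. (fst p, snd p)) \<in> M \<Otimes>\<^sub>M lborel \<rightarrow>\<^sub>M (lborel :: real measure) \<Otimes>\<^sub>M (lborel :: complex measure)"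
    proof (rule measurable_Pair)
      show "fst \<in> M \<Otimes>\<^sub>M lborel \<rightarrow>\<^sub>M lborel"
        by (rule measurable_compose[OF measurable_fst]) (simp add: M_def measurable_restrict_space1)
    qed simp
    from measurable_compose[OF this *] show ?thesis by (simp add: case_prod_beta)
  qed
  \<comment> \<open>The integral of the absolute value over \<open>z\<close> is the same for every
    \<open>t\<close>, and the range of \<open>t\<close> has finite measure.\<close>
  have Fint: "integrable (M \<Otimes>\<^sub>M lborel) (\<lambda>(t, z). w (cis t * z))"
    by (rule P.Fubini_integrable[OF meas]) (use rot[of "\<lambda>x. \<bar>x\<bar>"] roti in auto)
  have "(\<integral>z. (\<integral>t. w (cis t * z) \<partial>M) \<partial>lborel) = (\<integral>t. (\<integral>z. w (cis t * z) \<partial>lborel) \<partial>M)"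
    by (rule P.Fubini_integral[OF Fint])
  also have "\<dots> = measure M (space M) * (\<integral>z. w z \<partial>lborel)"
    using rot[of "\<lambda>x. x"] by simp
  also have "measure M (space M) = 2 * pi"
    by (simp add: M_def space_restrict_space measure_restrict_space)
  finally have "2 * pi * (\<integral>z. w z \<partial>lborel) = (\<integral>z. (\<integral>t. w (cis t * z) \<partial>M) \<partial>lborel)" by simp
  also have "\<dots> = 0"
  proof (rule integral_eq_zero_AE, use circ in eventually_elim)
    case (elim z)
    have "w (cis t * z) = indicator (ball 0 R) z * v (cis t * z)" for t
      by (simp add: w_def norm_mult indicator_def)
    then show ?case using elim by (cases "z \<in> ball 0 R") (auto simp: M_def)
  qed
  finally show ?thesis by (simp add: w_def)
qed

section \<open>Area integrals of the kernels 1 / |z - a| and z / (z - a)\<close>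

text \<open>On the annulus between radii r / 2^(k+1) and r / 2^k the kernel is at most 2^(k+1) / r.
  Replacing the annulus by the whole disc gives 2 pi r / 2^k, and the geometric series sums to 4 pi
  r, twice the exact value.\<close>

lemma nn_integral_inverse_dist:
  fixes a :: complex
  assumes r: "r > 0"
  shows "(\<integral>\<^sup>+z\<in>ball a r. ennreal (1 / norm (z - a)) \<partial>lborel) \<le> ennreal (4 * pi * r)"
proof -
  have "(\<integral>\<^sup>+z\<in>ball a r. ennreal (1 / norm (z - a)) \<partial>lborel) \<le>
     (\<integral>\<^sup>+z. (\<Sum>k. ennreal (2 ^ Suc k / r) * indicator (ball a (r / 2 ^ k)) z) \<partial>lborel)"
  proof (rule nn_integral_mono)
    fix z :: complex
    show "ennreal (1 / norm (z - a)) * indicator (ball a r) z \<le>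
        (\<Sum>k. ennreal (2 ^ Suc k / r) * indicator (ball a (r / 2 ^ k)) z)"
    \<comment> \<open>In the complementary case the left side is 0, at \<open>z = a\<close> because
      division by zero yields 0.\<close>
    proof (cases "z \<in> ball a r \<and> z \<noteq> a")
      case True
      then have d: "norm (z - a) > 0" "norm (z - a) < r" by (auto simp: dist_norm norm_minus_commute)
      have "\<exists>k. r / 2 ^ Suc k \<le> norm (z - a)"
      proof -
        obtain n where "r / norm (z - a) < 2 ^ n" using real_arch_pow[of 2] by auto
        then have "r / 2 ^ n \<le> norm (z - a)" using d by (simp add: field_simps)
        moreover have "r / 2 ^ Suc n \<le> r / 2 ^ n" using r by (simp add: field_simps)
        ultimately have "r / 2 ^ Suc n \<le> norm (z - a)" by linarith
        then show ?thesis ..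
      qed
      define k where "k = (LEAST k. r / 2 ^ Suc k \<le> norm (z - a))"
      have k1: "r / 2 ^ Suc k \<le> norm (z - a)" unfolding k_def by (rule LeastI_ex) fact
      have k2: "norm (z - a) < r / 2 ^ k"
      proof (cases k)
        case (Suc j)
        then have "j < k" by simp
        from not_less_Least[OF this[unfolded k_def]] show ?thesis using Suc by simp
      qed (use d in simp)
      have "1 / norm (z - a) \<le> 2 ^ Suc k / r" using k1 d r by (simp add: field_simps)
      then have "ennreal (1 / norm (z - a)) * indicator (ball a r) z \<le>
          ennreal (2 ^ Suc k / r) * indicator (ball a (r / 2 ^ k)) z"
        using True k2 by (simp add: dist_norm norm_minus_commute ennreal_leI)
      also have "\<dots> \<le> (\<Sum>k. ennreal (2 ^ Suc k / r) * indicator (ball a (r / 2 ^ k)) z)"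
      proof -
        let ?g = "\<lambda>k. ennreal (2 ^ Suc k / r) * indicator (ball a (r / 2 ^ k)) z"
        have "sum ?g {k} \<le> suminf ?g" by (rule sum_le_suminf) auto
        also have "sum ?g {k} = ?g k" by (rule trans[OF sum.insert]) auto
        finally show ?thesis .
      qed
      finally show ?thesis .
    qed auto
  qed
  also have "\<dots> = (\<Sum>k. \<integral>\<^sup>+z. ennreal (2 ^ Suc k / r) * indicator (ball a (r / 2 ^ k)) z \<partial>lborel)"
    by (intro nn_integral_suminf borel_measurable_times_ennreal borel_measurable_indicator) auto
  also have "\<dots> = (\<Sum>k. ennreal (2 * pi * r * (1 / 2) ^ k))"
  proof (rule suminf_cong)
    fix k
    have "(\<integral>\<^sup>+z. ennreal (2 ^ Suc k / r) * indicator (ball a (r / 2 ^ k)) z \<partial>lborel) =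
        ennreal (2 ^ Suc k / r) * ennreal (pi * (r / 2 ^ k)\<^sup>2)"
      using r by (subst nn_integral_cmult_indicator) (simp_all add: emeasure_ball unit_ball_vol_2)
    also have "\<dots> = ennreal (2 * pi * r * (1 / 2) ^ k)"
      using r by (simp add: ennreal_mult'[symmetric] field_simps power2_eq_square)
    finally show "(\<integral>\<^sup>+z. ennreal (2 ^ Suc k / r) * indicator (ball a (r / 2 ^ k)) z \<partial>lborel) =
      ennreal (2 * pi * r * (1 / 2) ^ k)" .
  qed
  also have "\<dots> = ennreal (4 * pi * r)"
  proof (rule suminf_ennreal_eq)
    show "(\<lambda>k. 2 * pi * r * (1 / 2) ^ k) sums (4 * pi * r)"
      using sums_mult[OF geometric_sums[of "1/2::real"], of "2 * pi * r"] by (simp add: mult.assoc)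
  qed (use r in auto)
  finally show ?thesis .
qed

text \<open>A zero \<open>a\<close> contributes \<open>z / (z - a)\<close> to \<open>z f' / f\<close>; on the disc of radius \<open>R\<close> this is compared
  with 1 or 0 according to whether \<open>a\<close> lies in the disc.\<close>

lemma nn_integral_log_deriv_kernel:
  fixes a :: complex
  assumes R: "R > 0"
  shows "(\<integral>\<^sup>+z\<in>ball 0 R. ennreal (norm (z / (z - a) - (if norm a \<le> R then 1 else 0))) \<partial>lborel)
     \<le> ennreal (24 * pi * R\<^sup>2 * min (norm a / R) (R / norm a))"
proof -
  define b :: complex where "b = (if norm a \<le> R then 1 else 0)"
  have AEa: "AE z in lborel. z \<noteq> a" by (rule AE_lborel_singleton)
  have *: "(\<integral>\<^sup>+z\<in>ball 0 R. ennreal (norm (z / (z - a) - b)) \<partial>lborel) \<le> ennreal (c * (4 * pi * s))"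
    if c: "c \<ge> 0" and s: "norm a + R \<le> s"
      and bd: "\<And>z. norm z < R \<Longrightarrow> z \<noteq> a \<Longrightarrow> norm (z / (z - a) - b) \<le> c * (1 / norm (z - a))" for c s
  proof -
    have sub: "ball 0 R \<subseteq> ball a s"
    proof
      fix z :: complex assume "z \<in> ball 0 R"
      then show "z \<in> ball a s" using s norm_triangle_ineq4[of a z] by (simp add: dist_norm)
    qed
    have "(\<lambda>z. ennreal (1 / norm (z - a))) \<in> borel_measurable borel" by measurable
    then have [simp]: "(\<lambda>z. ennreal (1 / norm (z - a)) * indicator (ball a s) z) \<in> borel_measurable borel"
      by (intro borel_measurable_times_ennreal borel_measurable_indicator) auto
    have s0: "s > 0" using s R norm_ge_zero[of a] by linarith
    have "(\<integral>\<^sup>+z\<in>ball 0 R. ennreal (norm (z / (z - a) - b)) \<partial>lborel) \<le>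
       (\<integral>\<^sup>+z. ennreal c * (ennreal (1 / norm (z - a)) * indicator (ball a s) z) \<partial>lborel)"
    proof (rule nn_integral_mono_AE, use AEa in eventually_elim)
      case (elim z)
      show ?case
      proof (cases "z \<in> ball 0 R")
        case True
        then have "ennreal (norm (z / (z - a) - b)) \<le> ennreal (c * (1 / norm (z - a)))"
          using elim by (intro ennreal_leI bd) auto
        moreover have "z \<in> ball a s" using True sub by blast
        moreover have "ennreal (c * (1 / norm (z - a))) = ennreal c * ennreal (1 / norm (z - a))"
          using c by (rule ennreal_mult')
        ultimately show ?thesis using True by simp
      qed simp
    qed
    also have "\<dots> = ennreal c * (\<integral>\<^sup>+z\<in>ball a s. ennreal (1 / norm (z - a)) \<partial>lborel)"
      by (rule nn_integral_cmult) simp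
    also have "\<dots> \<le> ennreal c * ennreal (4 * pi * s)"
      by (intro mult_left_mono nn_integral_inverse_dist s0) simp
    also have "\<dots> = ennreal (c * (4 * pi * s))" using c by (simp add: ennreal_mult')
    finally show ?thesis .
  qed
  \<comment> \<open>For a zero inside, the difference is a / (z - a), giving 8 pi R |a|. For R < |a|
    \<le> 2R the numerator is at most \<open>R\<close> and R / |a| \<ge> 1/2, so 12 pi R^2 becomes
    24 pi R^2 times the weight; this case fixes the constant. Beyond 2R the kernel is bounded by 2R
    / |a| pointwise.\<close>
  consider "norm a \<le> R" | "R < norm a" "norm a \<le> 2 * R" | "2 * R < norm a" by linarith
  then have "(\<integral>\<^sup>+z\<in>ball 0 R. ennreal (norm (z / (z - a) - b)) \<partial>lborel)
     \<le> ennreal (24 * pi * R\<^sup>2 * min (norm a / R) (R / norm a))"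
  proof cases
    case 1
    have "(\<integral>\<^sup>+z\<in>ball 0 R. ennreal (norm (z / (z - a) - b)) \<partial>lborel) \<le> ennreal (norm a * (4 * pi * (2 * R)))"
    proof (rule *)
      fix z assume "z \<noteq> a"
      then have "z / (z - a) - b = a / (z - a)" using 1 by (simp add: b_def field_simps)
      then show "norm (z / (z - a) - b) \<le> norm a * (1 / norm (z - a))" by (simp add: norm_divide)
    qed (use 1 in auto)
    also have "\<dots> \<le> ennreal (24 * pi * R\<^sup>2 * min (norm a / R) (R / norm a))"
    proof (cases "a = 0")
      case False
      then have "norm a / R \<le> R / norm a"
        using 1 R mult_mono[of "norm a" R "norm a" R] by (simp add: field_simps)
      then have "min (norm a / R) (R / norm a) = norm a / R" by simp
      then show ?thesis using R by (intro ennreal_leI) (simp add: power2_eq_square)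
    qed simp
    finally show ?thesis .
  next
    case 2
    have mn: "min (norm a / R) (R / norm a) = R / norm a"
    proof -
      have "R < norm a" using 2 R by linarith
      then have "R / norm a \<le> 1" "1 \<le> norm a / R" using R by (simp_all add: divide_le_eq le_divide_eq)
      then show ?thesis by linarith
    qed
    have "(\<integral>\<^sup>+z\<in>ball 0 R. ennreal (norm (z / (z - a) - b)) \<partial>lborel) \<le> ennreal (R * (4 * pi * (3 * R)))"
      by (rule *) (use 2 R in \<open>auto simp: b_def norm_divide divide_right_mono\<close>)
    also have "\<dots> \<le> ennreal (24 * pi * R\<^sup>2 * (R / norm a))"
    proof (rule ennreal_leI)
      have "1 / 2 \<le> R / norm a" using 2 R by (subst le_divide_eq) auto
      then have "24 * pi * R\<^sup>2 * (1 / 2) \<le> 24 * pi * R\<^sup>2 * (R / norm a)" by (intro mult_left_mono) auto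
      then show "R * (4 * pi * (3 * R)) \<le> 24 * pi * R\<^sup>2 * (R / norm a)" by (simp add: power2_eq_square mult_ac)
    qed
    finally show ?thesis using mn by simp
  next
    case 3
    have mn: "min (norm a / R) (R / norm a) = R / norm a"
    proof -
      have "R < norm a" using 3 R by linarith
      then have "R / norm a \<le> 1" "1 \<le> norm a / R" using R by (simp_all add: divide_le_eq le_divide_eq)
      then show ?thesis by linarith
    qed
    have "(\<integral>\<^sup>+z\<in>ball 0 R. ennreal (norm (z / (z - a) - b)) \<partial>lborel) \<le>
       (\<integral>\<^sup>+z\<in>ball 0 R. ennreal (2 * R / norm a) \<partial>(lborel :: complex measure))"
    proof (rule nn_integral_mono)
      fix z :: complex
      show "ennreal (norm (z / (z - a) - b)) * indicator (ball 0 R) z \<le>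
          ennreal (2 * R / norm a) * indicator (ball 0 R) z"
      proof (cases "z \<in> ball 0 R")
        case True
        then have z: "norm z < R" by simp
        have ge: "norm (z - a) \<ge> norm a / 2"
          using z 3 norm_triangle_ineq2[of a z] by (simp add: norm_minus_commute)
        have "norm z / norm (z - a) \<le> R / (norm a / 2)"
          using z 3 R ge by (intro frac_le) auto
        then have "norm (z / (z - a) - b) \<le> 2 * R / norm a"
          using 3 R by (simp add: b_def norm_divide mult.commute)
        then show ?thesis using True by (simp add: ennreal_leI)
      qed simp
    qed
    also have "\<dots> = ennreal (2 * R / norm a) * ennreal (pi * R\<^sup>2)"
      using R by (simp add: nn_integral_cmult_indicator emeasure_ball unit_ball_vol_2)
    also have "\<dots> = ennreal (2 * R / norm a * (pi * R\<^sup>2))"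
      using R by (intro ennreal_mult'[symmetric]) auto
    also have "\<dots> \<le> ennreal (24 * pi * R\<^sup>2 * (R / norm a))"
      using R by (intro ennreal_leI) (simp add: divide_right_mono mult_right_mono)
    finally show ?thesis using mn by simp
  qed
  then show ?thesis by (simp add: b_def)
qed
subsection \<open>The argument of a holomorphic function along circles\<close>

text \<open>An antiderivative of a periodic function increases by the same amount over each period;
  subtracting the mean \<open>c\<close> makes this amount zero.\<close>

lemma antiderivative_cos_composed_periodic:
  fixes \<psi> :: "real \<Rightarrow> real"
  assumes \<psi>: "continuous_on UNIV \<psi>"
  defines "c \<equiv> integral {-pi..pi} (\<lambda>x. \<psi> (cos x)) / (2 * pi)"
  obtains G where "\<And>x. (G has_field_derivative \<psi> (cos (x - \<beta>)) - c) (at x)"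
    "\<And>x n. G (x + of_int n * (2 * pi)) = G x"
proof -
  define g where "g = (\<lambda>x. \<psi> (cos x))"
  have gc: "continuous_on UNIV g" unfolding g_def
    by (intro continuous_on_compose2[OF \<psi>] continuous_intros) auto
  then have "isCont g x" for x by (simp add: continuous_on_eq_continuous_at)
  then obtain F where "\<And>x. (F has_vector_derivative g x) (at x)"
    using einterval_antiderivative[of "-\<infinity>" "\<infinity>" g] by auto
  then have F: "(F has_field_derivative g x) (at x)" for x
    by (simp add: has_real_derivative_iff_has_vector_derivative)
  have "((\<lambda>x. F (x + 2 * pi) - F x) has_field_derivative 0) (at x)" for x
  proof -
    have "((\<lambda>x. F (x + 2 * pi)) has_field_derivative g (x + 2 * pi) * 1) (at x)"
      by (rule DERIV_chain2[OF F]) (auto intro!: derivative_eq_intros)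
    moreover have "g (x + 2 * pi) = g x" by (simp add: g_def)
    ultimately show ?thesis using DERIV_diff[OF _ F[of x]] by fastforce
  qed
  then have const: "F (x + 2 * pi) - F x = F (- pi + 2 * pi) - F (- pi)" for x
    using DERIV_isconst_all by blast
  have "(g has_integral F pi - F (- pi)) {-pi..pi}"
    using F by (intro fundamental_theorem_of_calculus)
      (auto simp: has_real_derivative_iff_has_vector_derivative intro: has_vector_derivative_at_within)
  then have c: "2 * pi * c = F pi - F (- pi)" by (simp add: c_def g_def[symmetric] integral_unique)
  have shift: "F (x + 2 * pi) = F x + 2 * pi * c" for x using const[of x] c by simp
  define G where "G = (\<lambda>x. F (x - \<beta>) - c * x)"
  have "(G has_field_derivative \<psi> (cos (x - \<beta>)) - c) (at x)" for x
  proof -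
    have "((\<lambda>x. F (x - \<beta>)) has_field_derivative g (x - \<beta>) * 1) (at x)"
      by (rule DERIV_chain2[OF F]) (auto intro!: derivative_eq_intros)
    then show ?thesis unfolding G_def
      by (auto intro!: derivative_eq_intros simp: g_def)
  qed
  moreover interpret periodic_fun_simple G "2 * pi"
  proof
    fix x show "G (x + 2 * pi) = G x"
      using shift[of "x - \<beta>"] by (simp add: G_def algebra_simps)
  qed
  have "G (x + of_int n * (2 * pi)) = G x" for x n by (rule plus_of_int)
  ultimately show ?thesis using that by blast
qed

text \<open>The logarithmic derivative of t \<mapsto> f(e^(it) z) is \<open>q\<close>. Integrating
  \<open>q\<close> from a logarithm of the initial value gives \<open>L\<close>, and
  \<open>f\<close> times \<open>exp (- L)\<close> has derivative zero along the circle.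
  \<open>L\<close> need not close up after a full turn, since \<open>f\<close> may have zeros inside
  the circle.\<close>

lemma holomorphic_argument_lift:
  fixes f :: "complex \<Rightarrow> complex"
  assumes f: "f holomorphic_on UNIV" and nz: "\<And>t. f (cis t * z) \<noteq> 0"
  defines "q \<equiv> \<lambda>t. \<i> * (cis t * z * deriv f (cis t * z) / f (cis t * z))"
  obtains L where "continuous_on UNIV q"
    "\<And>t. t \<in> {0..2 * pi} \<Longrightarrow> (L has_vector_derivative q t) (at t within {0..2 * pi})"
    "\<And>t. t \<in> {0..2 * pi} \<Longrightarrow> f (cis t * z) = exp (L t)"
proof -
  define p where "p = (\<lambda>t. f (cis t * z))"
  have cz: "continuous_on UNIV (\<lambda>t. cis t * z)" unfolding cis_conv_exp by (intro continuous_intros)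
  have "continuous_on UNIV f" "continuous_on UNIV (deriv f)"
    using f holomorphic_deriv[OF f open_UNIV] by (auto intro: holomorphic_on_imp_continuous_on)
  then have fc: "continuous_on UNIV (\<lambda>t. f (cis t * z))" "continuous_on UNIV (\<lambda>t. deriv f (cis t * z))"
    using continuous_on_compose2[OF _ cz] by blast+
  have qc: "continuous_on UNIV q" unfolding q_def
    by (intro continuous_on_mult continuous_on_divide cz fc continuous_on_const ballI nz)
  then have "continuous_on {0..2 * pi} q" by (rule continuous_on_subset) simp
  then obtain Q where Q: "\<And>t. t \<in> {0..2 * pi} \<Longrightarrow> (Q has_vector_derivative q t) (at t within {0..2 * pi})"
    using antiderivative_continuous by blast
  define L where "L = (\<lambda>t. Ln (p 0) + (Q t - Q 0))"
  have L: "(L has_vector_derivative q t) (at t within {0..2 * pi})" if "t \<in> {0..2 * pi}" for t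
    unfolding L_def by (auto intro!: derivative_eq_intros Q that)
  have p': "(p has_vector_derivative q t * p t) (at t within {0..2 * pi})" for t
  proof -
    have "((\<lambda>w. f (exp (\<i> * w) * z)) has_field_derivative
        deriv f (exp (\<i> * of_real t) * z) * (exp (\<i> * of_real t) * \<i> * z)) (at (of_real t))"
    proof (rule DERIV_chain2[where f = f and g = "\<lambda>w. exp (\<i> * w) * z"])
      show "(f has_field_derivative deriv f (exp (\<i> * of_real t) * z)) (at (exp (\<i> * of_real t) * z))"
        using f by (auto intro: holomorphic_derivI)
      show "((\<lambda>w. exp (\<i> * w) * z) has_field_derivative exp (\<i> * of_real t) * \<i> * z) (at (of_real t))"
        by (auto intro!: derivative_eq_intros)
    qed
    then have "((\<lambda>t. f (exp (\<i> * of_real t) * z)) has_vector_derivative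
        deriv f (exp (\<i> * of_real t) * z) * (exp (\<i> * of_real t) * \<i> * z)) (at t within {0..2 * pi})"
      by (rule has_vector_derivative_real_field)
    moreover have "deriv f (exp (\<i> * of_real t) * z) * (exp (\<i> * of_real t) * \<i> * z) = q t * p t"
      using nz[of t] by (simp add: q_def p_def cis_conv_exp)
    ultimately show ?thesis by (simp add: p_def cis_conv_exp)
  qed
  have E: "((\<lambda>t. exp (- L t)) has_vector_derivative - q t * exp (- L t)) (at t within {0..2 * pi})"
    if "t \<in> {0..2 * pi}" for t
  proof -
    have "((\<lambda>t. - L t) has_vector_derivative - q t) (at t within {0..2 * pi})"
      by (intro derivative_intros L that)
    then have "(exp \<circ> (\<lambda>t. - L t) has_vector_derivative - q t * exp (- L t)) (at t within {0..2 * pi})"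
      by (rule field_vector_diff_chain_within) (auto intro!: derivative_eq_intros)
    then show ?thesis by (simp add: o_def)
  qed
  have "((\<lambda>t. p t * exp (- L t)) has_vector_derivative 0) (at t within {0..2 * pi})"
    if "t \<in> {0..2 * pi}" for t
    using has_vector_derivative_mult[OF p'[of t] E[OF that]] by (simp add: algebra_simps)
  then obtain k where k: "\<And>t. t \<in> {0..2 * pi} \<Longrightarrow> p t * exp (- L t) = k"
    using has_vector_derivative_zero_constant[of "{0..2 * pi}" "\<lambda>t. p t * exp (- L t)"] by auto
  have "p 0 \<noteq> 0" unfolding p_def by (rule nz)
  then have "k = 1" using k[of 0] by (simp add: L_def exp_minus)
  then have "p t = exp (L t)" if "t \<in> {0..2 * pi}" for t
    using k[OF that] by (simp add: exp_minus field_simps)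
  then show ?thesis using that[of L] qc L by (auto simp: p_def)
qed

text \<open>On the circle, \<open>Re (z f' / f)\<close> is the angular derivative of a continuous argument of \<open>f\<close>,
  so the integrand is the derivative of \<open>G (arg f)\<close> with \<open>G\<close> periodic.\<close>

lemma circle_integral_argument_zero:
  fixes f :: "complex \<Rightarrow> complex" and \<psi> :: "real \<Rightarrow> real"
  assumes f: "f holomorphic_on UNIV" and nz: "\<And>t. f (cis t * z) \<noteq> 0"
    and \<psi>: "continuous_on UNIV \<psi>"
  defines "c \<equiv> integral {-pi..pi} (\<lambda>x. \<psi> (cos x)) / (2 * pi)"
  shows "integral\<^sup>L (restrict_space lborel {0..2 * pi})
     (\<lambda>t. (\<psi> (Re (f (cis t * z) * cis (- \<beta>)) / norm (f (cis t * z))) - c) *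
        Re (cis t * z * deriv f (cis t * z) / f (cis t * z))) = 0"
proof -
  obtain G where G: "\<And>x. (G has_field_derivative \<psi> (cos (x - \<beta>)) - c) (at x)"
    "\<And>x n. G (x + of_int n * (2 * pi)) = G x"
    using antiderivative_cos_composed_periodic[OF \<psi>] unfolding c_def by metis
  define q where "q = (\<lambda>t. \<i> * (cis t * z * deriv f (cis t * z) / f (cis t * z)))"
  obtain L where qc: "continuous_on UNIV q"
    and L: "\<And>t. t \<in> {0..2 * pi} \<Longrightarrow> (L has_vector_derivative q t) (at t within {0..2 * pi})"
    and fL: "\<And>t. t \<in> {0..2 * pi} \<Longrightarrow> f (cis t * z) = exp (L t)"
    using holomorphic_argument_lift[OF f nz] unfolding q_def by metis
  define w where "w = (\<lambda>t. (\<psi> (cos (Im (L t) - \<beta>)) - c) * Im (q t))"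
  have deriv: "((\<lambda>t. G (Im (L t))) has_vector_derivative w t) (at t within {0..2 * pi})"
    if "t \<in> {0..2 * pi}" for t
  proof -
    have "((\<lambda>t. Im (L t)) has_vector_derivative Im (q t)) (at t within {0..2 * pi})"
      by (rule bounded_linear.has_vector_derivative[OF bounded_linear_Im L[OF that]])
    then have "(G \<circ> (\<lambda>t. Im (L t)) has_vector_derivative Im (q t) * (\<psi> (cos (Im (L t) - \<beta>)) - c)) (at t within {0..2 * pi})"
      by (rule field_vector_diff_chain_within) (rule has_field_derivative_at_within[OF G(1)])
    then show ?thesis by (simp add: o_def w_def mult.commute)
  qed
  have "continuous_on {0..2 * pi} L"
    using has_vector_derivative_continuous[OF L] by (simp add: continuous_on_eq_continuous_within)
  then have cont: "continuous_on {0..2 * pi} w" unfolding w_def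
    by (intro continuous_intros continuous_on_compose2[OF \<psi>] continuous_on_subset[OF qc]) auto
  have "exp (L (2 * pi)) = exp (L 0)" using fL[of 0] fL[of "2 * pi"] by simp
  \<comment> \<open>The integer \<open>n\<close> is the winding number of \<open>f\<close> along the
    circle; periodicity of \<open>G\<close> absorbs it.\<close>
  then obtain n :: int where "L (2 * pi) = L 0 + of_int (2 * n) * pi * \<i>"
    using exp_eq by auto
  then have "Im (L (2 * pi)) = Im (L 0) + of_int n * (2 * pi)" by simp
  then have per: "G (Im (L (2 * pi))) = G (Im (L 0))" using G(2) by simp
  have eq: "(\<psi> (Re (f (cis t * z) * cis (- \<beta>)) / norm (f (cis t * z))) - c) *
        Re (cis t * z * deriv f (cis t * z) / f (cis t * z)) = w t" if "t \<in> {0..2 * pi}" for t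
  proof -
    have "Re (f (cis t * z) * cis (- \<beta>)) / norm (f (cis t * z)) = cos (Im (L t) - \<beta>)"
      unfolding fL[OF that] by (simp add: Re_exp Im_exp cos_diff algebra_simps add_divide_distrib diff_divide_distrib)
    moreover have "Im (q t) = Re (cis t * z * deriv f (cis t * z) / f (cis t * z))"
      unfolding q_def by (rule Im_i_times)
    ultimately show ?thesis unfolding w_def by (simp only:)
  qed
  have "(\<integral>t. indicator {0..2 * pi} t *\<^sub>R w t \<partial>lborel) = G (Im (L (2 * pi))) - G (Im (L 0))"
    by (rule integral_FTC_Icc[OF _ deriv cont]) auto
  then have "(\<integral>t. indicator {0..2 * pi} t *\<^sub>R w t \<partial>lborel) = 0" using per by simp
  also have "(\<integral>t. indicator {0..2 * pi} t *\<^sub>R w t \<partial>lborel) =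
     (\<integral>t. indicator {0..2 * pi} t *\<^sub>R ((\<psi> (Re (f (cis t * z) * cis (- \<beta>)) / norm (f (cis t * z))) - c) *
        Re (cis t * z * deriv f (cis t * z) / f (cis t * z))) \<partial>lborel)"
  proof (intro Bochner_Integration.integral_cong refl)
    fix t :: real
    show "indicator {0..2 * pi} t *\<^sub>R w t = indicator {0..2 * pi} t *\<^sub>R
       ((\<psi> (Re (f (cis t * z) * cis (- \<beta>)) / norm (f (cis t * z))) - c) *
        Re (cis t * z * deriv f (cis t * z) / f (cis t * z)))"
      by (cases "t \<in> {0..2 * pi}") (simp_all only: eq, simp)
  qed
  finally show ?thesis by (subst integral_restrict_space) (simp, simp only:)
qed

text \<open>Membership depends only on the angle to the bisector. That angle can be taken in
  [-pi, pi], where the cosine is even and decreasing in the absolute value, and the half opening is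
  at most pi.\<close>

lemma sector_iff:
  assumes "\<theta>1 < \<theta>2" "\<theta>2 - \<theta>1 \<le> 2 * pi"
  shows "w \<in> sector \<theta>1 \<theta>2 \<longleftrightarrow>
    w \<noteq> 0 \<and> Re (w * cis (- ((\<theta>1 + \<theta>2) / 2))) / norm w > cos ((\<theta>2 - \<theta>1) / 2)"
proof (cases "w = 0")
  case False
  define \<beta> where "\<beta> = (\<theta>1 + \<theta>2) / 2"
  define \<kappa> where "\<kappa> = (\<theta>2 - \<theta>1) / 2"
  have \<kappa>: "0 < \<kappa>" "\<kappa> \<le> pi" using assms by (auto simp: \<kappa>_def)
  have th: "\<theta>1 = \<beta> - \<kappa>" "\<theta>2 = \<beta> + \<kappa>" by (simp_all add: \<beta>_def \<kappa>_def field_simps)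
  have Re: "Re (w * cis (- \<beta>)) / norm w = cos (\<theta> - \<beta>)" if "is_Arg w \<theta>" for \<theta>
  proof -
    have w: "w = norm w * cis \<theta>" using that by (simp add: is_Arg_def cis_conv_exp)
    have "Re (of_real (norm w) * cis \<theta> * cis (- \<beta>)) = norm w * cos (\<theta> - \<beta>)"
      by (simp add: mult.assoc cis_mult)
    then have "Re (w * cis (- \<beta>)) = norm w * cos (\<theta> - \<beta>)" using w by metis
    then show ?thesis using False by simp
  qed
  have "w \<in> sector \<theta>1 \<theta>2 \<longleftrightarrow> Re (w * cis (- \<beta>)) / norm w > cos \<kappa>"
  proof
    assume "w \<in> sector \<theta>1 \<theta>2"
    then obtain \<theta> where \<theta>: "is_Arg w \<theta>" "\<theta>1 < \<theta>" "\<theta> < \<theta>2" by (auto simp: sector_def)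
    have "cos \<kappa> < cos \<bar>\<theta> - \<beta>\<bar>"
      using \<theta> \<kappa> by (intro cos_monotone_0_pi) (auto simp: th)
    then show "Re (w * cis (- \<beta>)) / norm w > cos \<kappa>" using Re[OF \<theta>(1)] by simp
  next
    assume gt: "Re (w * cis (- \<beta>)) / norm w > cos \<kappa>"
    define \<phi> where "\<phi> = Arg (w * cis (- \<beta>))"
    have \<phi>: "- pi < \<phi>" "\<phi> \<le> pi" using Arg_bounded by (auto simp: \<phi>_def)
    have "w * cis (- \<beta>) = norm w * cis \<phi>"
      using Arg_eq[of "w * cis (- \<beta>)"] False by (simp add: \<phi>_def norm_mult cis_conv_exp)
    then have "w * cis (- \<beta>) * cis \<beta> = norm w * cis \<phi> * cis \<beta>" by simp
    then have "w = norm w * cis (\<phi> + \<beta>)" by (simp add: mult.assoc cis_mult)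
    then have arg: "is_Arg w (\<phi> + \<beta>)" unfolding is_Arg_def cis_conv_exp .
    have "cos \<kappa> < cos \<bar>\<phi>\<bar>" using gt Re[OF arg] by simp
    moreover have "\<bar>\<phi>\<bar> \<le> pi" using \<phi> by auto
    ultimately have "\<bar>\<phi>\<bar> < \<kappa>" using \<kappa> cos_monotone_0_pi_le[of \<kappa> "\<bar>\<phi>\<bar>"] by force
    then show "w \<in> sector \<theta>1 \<theta>2" unfolding sector_def
      using False arg by (auto simp: th intro!: exI[of _ "\<phi> + \<beta>"])
  qed
  then show ?thesis using False by (simp add: \<beta>_def \<kappa>_def)
qed (simp add: sector_def)
subsection \<open>Equidistribution of the argument\<close>

text \<open>Two radii are involved. \<open>R\<close> is a concentration radius, for which the
  kernels of all zeros are small in total; \<rho> is chosen afterwards, so large compared with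
  \<open>R\<close> that the zero-free part hardly matters. Each source of error receives half of
  \<epsilon>.\<close>

lemma log_deriv_mean_deviation:
  fixes f :: "complex \<Rightarrow> complex"
  assumes f: "f holomorphic_on UNIV" "\<not> f constant_on UNIV" and ord: "entire_order f = 0" and "\<epsilon> > 0"
  shows "\<exists>R\<ge>R0. R > 0 \<and> (\<exists>N>0. (\<integral>\<^sup>+z\<in>ball 0 R. ennreal (norm (z * deriv f z / f z - of_real N)) \<partial>lborel)
            \<le> ennreal (\<epsilon> * N * (pi * R\<^sup>2)))"
proof -
  define Z where "Z = {a. f a = 0}"
  define m where "m = (\<lambda>a. real (nat (zorder f a)))"
  have m0: "m a \<ge> 0" for a by (simp add: m_def)
  have fin: "finite (Z \<inter> cball 0 r)" for r unfolding Z_def by (rule entire_zeros_finite[OF f])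
  obtain D where D1: "\<And>\<rho> M. \<rho> \<ge> 1 \<Longrightarrow> (\<And>z. norm z = 3 * \<rho> \<Longrightarrow> norm (f z) \<le> exp M) \<Longrightarrow>
       (\<Sum>a\<in>Z \<inter> cball 0 \<rho>. real (nat (zorder f a))) \<le> 2 * M + D"
    and D2: "\<And>\<rho> M z. \<rho> \<ge> 1 \<Longrightarrow> (\<And>z. norm z = 3 * \<rho> \<Longrightarrow> norm (f z) \<le> exp M) \<Longrightarrow>
       norm z \<le> \<rho> / 4 \<Longrightarrow> f z \<noteq> 0 \<Longrightarrow>
       norm (deriv f z / f z - (\<Sum>a\<in>Z \<inter> cball 0 \<rho>. of_nat (nat (zorder f a)) / (z - a)))
         \<le> 8 * (M + D) / \<rho>"
    by (rule log_deriv_zeros_approx[OF f, folded Z_def]) blast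
  have grow: "\<exists>r1. \<forall>r\<ge>r1. \<forall>z. norm z \<le> r \<longrightarrow> norm (f z) \<le> exp (r powr \<delta>)" if "\<delta> > 0" for \<delta>
    using entire_order_zero_growth[OF f(1) ord that] unfolding eventually_at_top_linorder .
  have growth: "\<exists>c. \<forall>i. (\<Sum>a\<in>Z \<inter> cball 0 (2 ^ i). m a) \<le> c * \<theta> ^ i" if "\<theta> > 1" for \<theta>
  proof -
    \<comment> \<open>With this exponent, (2^i)^\<delta> is exactly \<theta>^i.\<close>
    define \<delta> where "\<delta> = log 2 \<theta>"
    have "\<delta> > 0" using that by (simp add: \<delta>_def)
    then obtain r1 where r1: "\<And>r z. r \<ge> r1 \<Longrightarrow> norm z \<le> r \<Longrightarrow> norm (f z) \<le> exp (r powr \<delta>)"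
      using grow by blast
    obtain j where j: "r1 < 2 ^ j" using real_arch_pow[of 2 r1] by auto
    \<comment> \<open>Covers the finitely many scales at which the growth bound has not yet set
      in.\<close>
    define Nj where "Nj = (\<Sum>a\<in>Z \<inter> cball 0 (2 ^ j). m a)"
    have Nj0: "Nj \<ge> 0" unfolding Nj_def by (intro sum_nonneg m0)
    define c where "c = 2 * 3 powr \<delta> + \<bar>D\<bar> + Nj"
    have "(\<Sum>a\<in>Z \<inter> cball 0 (2 ^ i). m a) \<le> c * \<theta> ^ i" for i
    proof -
      have th1: "1 \<le> \<theta> ^ i" using that by (intro one_le_power) auto
      have c1: "\<bar>D\<bar> + Nj \<le> (\<bar>D\<bar> + Nj) * \<theta> ^ i"
        using mult_left_mono[OF th1, of "\<bar>D\<bar> + Nj"] Nj0 by simp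
      show ?thesis
      proof (cases "i \<le> j")
        case True
        then have "cball 0 (2 ^ i) \<subseteq> (cball 0 (2 ^ j) :: complex set)"
          by (intro subset_cball power_increasing) auto
        then have "(\<Sum>a\<in>Z \<inter> cball 0 (2 ^ i). m a) \<le> Nj"
          unfolding Nj_def using m0 by (intro sum_mono2 fin) auto
        moreover have "0 \<le> 2 * 3 powr \<delta> * \<theta> ^ i" using that by simp
        ultimately show ?thesis using c1 by (simp add: c_def algebra_simps)
      next
        case False
        then have "(2::real) ^ j \<le> 2 ^ i" by (intro power_increasing) auto
        moreover have "0 < (2::real) ^ i" by simp
        ultimately have "r1 \<le> 3 * 2 ^ i" using j by linarith
        then have "(\<Sum>a\<in>Z \<inter> cball 0 (2 ^ i). m a) \<le> 2 * (3 * 2 ^ i) powr \<delta> + D"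
          unfolding m_def by (intro D1 r1) auto
        also have "(3 * 2 ^ i) powr \<delta> = 3 powr \<delta> * \<theta> ^ i"
        proof -
          have "((2::real) ^ i) powr \<delta> = (2 powr \<delta>) ^ i"
            by (simp add: powr_realpow[symmetric] powr_powr mult.commute)
          also have "2 powr \<delta> = \<theta>" using that by (simp add: \<delta>_def)
          finally show ?thesis by (simp add: powr_mult)
        qed
        finally show ?thesis using c1 Nj0 by (simp add: c_def algebra_simps)
      qed
    qed
    then show ?thesis by blast
  qed
  obtain r1 where r1: "\<And>r z. r \<ge> r1 \<Longrightarrow> norm z \<le> r \<Longrightarrow> norm (f z) \<le> exp (r powr (1/2))"
    using grow[of "1/2"] by auto
  \<comment> \<open>Any growth exponent below 1 makes this remainder vanish; 1/2 is a convenient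
    choice.\<close>
  have lim: "((\<lambda>\<rho>. 8 * ((3 * \<rho>) powr (1/2) + D) / \<rho>) \<longlongrightarrow> 0) at_top" by real_asymp
  have large: "\<exists>\<rho>\<ge>x. \<rho> \<ge> 1 \<and> 8 * ((3 * \<rho>) powr (1/2) + D) / \<rho> < e \<and>
      (\<forall>z. norm z = 3 * \<rho> \<longrightarrow> norm (f z) \<le> exp ((3 * \<rho>) powr (1/2)))" if "e > 0" for x e
  proof -
    have "eventually (\<lambda>\<rho>. 8 * ((3 * \<rho>) powr (1/2) + D) / \<rho> < e) at_top"
      using order_tendstoD(2)[OF lim that] .
    then have "eventually (\<lambda>\<rho>. 8 * ((3 * \<rho>) powr (1/2) + D) / \<rho> < e \<and> \<rho> \<ge> x \<and> \<rho> \<ge> 1 \<and> \<rho> \<ge> \<bar>r1\<bar>) at_top"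
      by (intro eventually_conj eventually_ge_at_top)
    then obtain \<rho> where \<rho>: "8 * ((3 * \<rho>) powr (1/2) + D) / \<rho> < e" "\<rho> \<ge> x" "\<rho> \<ge> 1" "\<rho> \<ge> \<bar>r1\<bar>"
      using eventually_happens[of _ "at_top :: real filter"] by auto
    have "r1 \<le> 3 * \<rho>" using \<rho> by linarith
    then show ?thesis using \<rho> r1[of "3 * \<rho>"] by (intro exI[of _ \<rho>]) auto
  qed
  \<comment> \<open>Without zeros the remainder estimate bounds f' / f by arbitrarily small numbers
    at every point, forcing \<open>f\<close> to be constant.\<close>
  have "Z \<noteq> {}"
  proof
    assume Z0: "Z = {}"
    have "deriv f z / f z = 0" for z
    proof (rule ccontr)
      assume nz: "deriv f z / f z \<noteq> 0"
      then obtain \<rho> where \<rho>: "\<rho> \<ge> 4 * norm z" "\<rho> \<ge> 1"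
        "8 * ((3 * \<rho>) powr (1/2) + D) / \<rho> < norm (deriv f z / f z)"
        "\<And>z. norm z = 3 * \<rho> \<Longrightarrow> norm (f z) \<le> exp ((3 * \<rho>) powr (1/2))"
        using large[of "norm (deriv f z / f z)" "4 * norm z"] by auto
      have "norm (deriv f z / f z) \<le> 8 * ((3 * \<rho>) powr (1/2) + D) / \<rho>"
        using D2[OF \<rho>(2) \<rho>(4), of z] \<rho>(1) Z0 by (auto simp: Z_def)
      then show False using \<rho>(3) by simp
    qed
    then have "deriv f z = 0" for z using Z0 by (auto simp: Z_def)
    then have "(f has_field_derivative 0) (at z)" for z
      using holomorphic_derivI[OF f(1) open_UNIV, of z] by simp
    then have "f constant_on UNIV"
      using has_field_derivative_zero_constant[of UNIV f] by (auto simp: constant_on_def)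
    then show False using f by simp
  qed
  then obtain a0 where a0: "a0 \<in> Z" by auto
  obtain w0 where "f w0 \<noteq> 0" using f(2) by (auto simp: constant_on_def)
  then have "zorder f a0 > 0"
    using a0 zorder_exist_zero[OF f(1) open_UNIV connected_UNIV UNIV_I, of a0] by (auto simp: Z_def)
  then have ma0: "m a0 > 0" by (simp add: m_def)
  obtain i0 where i0: "R0 < 2 ^ i0" using real_arch_pow[of 2 R0] by auto
  \<comment> \<open>Multiplied by the kernel constant 24, this leaves \<epsilon>/2.\<close>
  have "\<epsilon> / 48 > 0" using \<open>\<epsilon> > 0\<close> by simp
  from concentration_radius[where Z = Z and m = m, OF m0 fin growth a0 ma0 this, of i0]
  obtain i where i: "i \<ge> i0" and Npos: "(\<Sum>a\<in>Z \<inter> cball 0 (2 ^ i). m a) > 0"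
    and K: "\<And>\<rho>. (\<Sum>a\<in>Z \<inter> cball 0 \<rho>. m a * min (norm a / 2 ^ i) (2 ^ i / norm a))
        \<le> \<epsilon> / 48 * (\<Sum>a\<in>Z \<inter> cball 0 (2 ^ i). m a)"
    by blast
  define R :: real where "R = 2 ^ i"
  define N where "N = (\<Sum>a\<in>Z \<inter> cball 0 R. m a)"
  have R: "R > 0" by (simp add: R_def)
  have N: "N > 0" using Npos by (simp add: N_def R_def)
  have "(2::real) ^ i0 \<le> R" unfolding R_def using i by (intro power_increasing) auto
  then have RR0: "R \<ge> R0" using i0 by simp
  define e where "e = \<epsilon> / 2 * N"
  have e: "e > 0" using N \<open>\<epsilon> > 0\<close> by (simp add: e_def)
  \<comment> \<open>The condition \<rho> \<ge> 4R puts the disc of radius \<open>R\<close> where the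
    remainder estimate applies. The concentration bound \<open>K\<close> holds for every \<rho>, so
    this choice may depend on \<open>R\<close> and \<open>N\<close>.\<close>
  obtain \<rho> where \<rho>: "\<rho> \<ge> 4 * R" "\<rho> \<ge> 1" "8 * ((3 * \<rho>) powr (1/2) + D) / \<rho> < e / R"
      "\<And>z. norm z = 3 * \<rho> \<Longrightarrow> norm (f z) \<le> exp ((3 * \<rho>) powr (1/2))"
    using large[of "e / R" "4 * R"] e R by auto
  define A where "A = Z \<inter> cball 0 \<rho>"
  have finA: "finite A" unfolding A_def by (rule fin)
  define k where "k = (\<lambda>a z. z / (z - a) - (if norm a \<le> R then 1 else (0::complex)))"
  have NA: "N = (\<Sum>a\<in>A. m a * (if norm a \<le> R then 1 else 0))"
  proof -
    have "(\<Sum>a\<in>A. m a * (if norm a \<le> R then 1 else 0)) = (\<Sum>a\<in>A. if a \<in> cball 0 R then m a else 0)"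
      by (intro sum.cong) auto
    also have "\<dots> = (\<Sum>a\<in>A \<inter> cball 0 R. m a)" by (rule sum.inter_restrict[OF finA, symmetric])
    also have "A \<inter> cball 0 R = Z \<inter> cball 0 R" using \<rho> R by (auto simp: A_def)
    finally show ?thesis by (simp add: N_def)
  qed
  have ptw: "norm (z * deriv f z / f z - of_real N) \<le> e + (\<Sum>a\<in>A. m a * norm (k a z))"
    if z: "norm z < R" "f z \<noteq> 0" for z
  proof -
    define S where "S = (\<Sum>a\<in>A. of_nat (nat (zorder f a)) / (z - a))"
    have "z * S - of_real N = (\<Sum>a\<in>A. of_real (m a) * k a z)"
      unfolding NA S_def k_def
      by (simp add: sum_distrib_left sum_subtractf[symmetric] m_def algebra_simps)
         (intro sum.cong refl, auto simp: algebra_simps)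
    then have "z * deriv f z / f z - of_real N = z * (deriv f z / f z - S) + (\<Sum>a\<in>A. of_real (m a) * k a z)"
      by (simp add: algebra_simps)
    also have "norm \<dots> \<le> norm z * norm (deriv f z / f z - S) + (\<Sum>a\<in>A. m a * norm (k a z))"
      using m0 by (intro order_trans[OF norm_triangle_ineq] add_mono order_trans[OF norm_sum] sum_mono)
        (auto simp: norm_mult)
    also have "norm (deriv f z / f z - S) \<le> e / R"
    proof -
      have "norm (deriv f z / f z - S) \<le> 8 * ((3 * \<rho>) powr (1/2) + D) / \<rho>"
        unfolding S_def A_def using z \<rho> by (intro D2) auto
      then show ?thesis using \<rho>(3) by linarith
    qed
    then have "norm z * norm (deriv f z / f z - S) \<le> R * (e / R)"
      using z e R by (intro mult_mono) auto
    finally show ?thesis using R by simp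
  qed
  have mk: "(\<lambda>z. ennreal (m a * norm (k a z)) * indicator (ball 0 R) z) \<in> borel_measurable lborel" for a
  proof -
    have "(\<lambda>z. z / (z - a)) \<in> borel_measurable borel" by measurable
    then have "(\<lambda>z. k a z) \<in> borel_measurable borel" unfolding k_def by measurable
    then have "(\<lambda>z. ennreal (m a * norm (k a z))) \<in> borel_measurable borel" by measurable
    then show ?thesis by (intro borel_measurable_times_ennreal borel_measurable_indicator) auto
  qed
  have me: "(\<lambda>z. ennreal e * indicator (ball 0 R) z) \<in> borel_measurable (lborel :: complex measure)"
    by (intro borel_measurable_times_ennreal borel_measurable_indicator) auto
  have "AE z in lborel. z \<notin> Z \<inter> cball 0 R"
    by (rule AE_not_in, rule finite_imp_null_set_lborel, rule fin)
  then have "(\<integral>\<^sup>+z\<in>ball 0 R. ennreal (norm (z * deriv f z / f z - of_real N)) \<partial>lborel) \<le>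
     (\<integral>\<^sup>+z. ennreal e * indicator (ball 0 R) z +
        (\<Sum>a\<in>A. ennreal (m a * norm (k a z)) * indicator (ball 0 R) z) \<partial>lborel)"
  proof (intro nn_integral_mono_AE, eventually_elim)
    case (elim z)
    show ?case
    proof (cases "z \<in> ball 0 R")
      case True
      then have "f z \<noteq> 0" using elim by (auto simp: Z_def)
      then have "ennreal (norm (z * deriv f z / f z - of_real N)) \<le> ennreal (e + (\<Sum>a\<in>A. m a * norm (k a z)))"
        using True by (intro ennreal_leI ptw) auto
      also have "\<dots> = ennreal e + (\<Sum>a\<in>A. ennreal (m a * norm (k a z)))"
        using e m0 by (simp add: sum_nonneg sum_ennreal)
      finally show ?thesis using True by simp
    qed simp
  qed
  also have "\<dots> = (\<integral>\<^sup>+z. ennreal e * indicator (ball 0 R) z \<partial>(lborel :: complex measure)) +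
       (\<Sum>a\<in>A. \<integral>\<^sup>+z. ennreal (m a * norm (k a z)) * indicator (ball 0 R) z \<partial>lborel)"
    using mk me by (subst nn_integral_add) (auto simp: nn_integral_sum)
  also have "(\<integral>\<^sup>+z. ennreal e * indicator (ball 0 R) z \<partial>(lborel :: complex measure)) = ennreal (e * (pi * R\<^sup>2))"
    using R e by (subst nn_integral_cmult_indicator) (auto simp: emeasure_ball unit_ball_vol_2 ennreal_mult')
  also have "(\<Sum>a\<in>A. \<integral>\<^sup>+z. ennreal (m a * norm (k a z)) * indicator (ball 0 R) z \<partial>lborel) \<le>
      (\<Sum>a\<in>A. ennreal (m a * (24 * pi * R\<^sup>2 * min (norm a / R) (R / norm a))))"
  proof (rule sum_mono)
    fix a assume "a \<in> A"
    have "(\<lambda>z. z / (z - a)) \<in> borel_measurable borel" by measurable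
    then have "(\<lambda>z. k a z) \<in> borel_measurable borel" unfolding k_def by measurable
    then have "(\<lambda>z. ennreal (norm (k a z))) \<in> borel_measurable borel" by measurable
    then have mm: "(\<lambda>z. ennreal (norm (k a z)) * indicator (ball 0 R) z) \<in> borel_measurable lborel"
      by (intro borel_measurable_times_ennreal borel_measurable_indicator) auto
    have "(\<integral>\<^sup>+z. ennreal (m a * norm (k a z)) * indicator (ball 0 R) z \<partial>lborel) =
      (\<integral>\<^sup>+z. ennreal (m a) * (ennreal (norm (k a z)) * indicator (ball 0 R) z) \<partial>lborel)"
      using m0 by (simp add: ennreal_mult' mult.assoc)
    also have "\<dots> = ennreal (m a) * (\<integral>\<^sup>+z\<in>ball 0 R. ennreal (norm (k a z)) \<partial>lborel)"
      by (rule nn_integral_cmult[OF mm])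
    also have "\<dots> \<le> ennreal (m a) * ennreal (24 * pi * R\<^sup>2 * min (norm a / R) (R / norm a))"
      unfolding k_def by (intro mult_left_mono nn_integral_log_deriv_kernel R) simp
    also have "\<dots> = ennreal (m a * (24 * pi * R\<^sup>2 * min (norm a / R) (R / norm a)))"
      by (rule ennreal_mult'[symmetric]) (rule m0)
    finally show "(\<integral>\<^sup>+z. ennreal (m a * norm (k a z)) * indicator (ball 0 R) z \<partial>lborel) \<le>
      ennreal (m a * (24 * pi * R\<^sup>2 * min (norm a / R) (R / norm a)))" .
  qed
  also have "(\<Sum>a\<in>A. ennreal (m a * (24 * pi * R\<^sup>2 * min (norm a / R) (R / norm a)))) =
      ennreal (\<Sum>a\<in>A. m a * (24 * pi * R\<^sup>2 * min (norm a / R) (R / norm a)))"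
    using m0 R by (intro sum_ennreal) simp
  also have "(\<Sum>a\<in>A. m a * (24 * pi * R\<^sup>2 * min (norm a / R) (R / norm a))) =
      24 * pi * R\<^sup>2 * (\<Sum>a\<in>A. m a * min (norm a / R) (R / norm a))"
    unfolding sum_distrib_left by (intro sum.cong refl) (simp add: mult_ac)
  also have "\<dots> \<le> 24 * pi * R\<^sup>2 * (\<epsilon> / 48 * N)"
    unfolding A_def N_def R_def by (intro mult_left_mono K) simp
  also have "ennreal (e * (pi * R\<^sup>2)) + ennreal (24 * pi * R\<^sup>2 * (\<epsilon> / 48 * N)) =
      ennreal (e * (pi * R\<^sup>2) + 24 * pi * R\<^sup>2 * (\<epsilon> / 48 * N))"
    using e N \<open>\<epsilon> > 0\<close> by (intro ennreal_plus[symmetric]) auto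
  also have "e * (pi * R\<^sup>2) + 24 * pi * R\<^sup>2 * (\<epsilon> / 48 * N) = \<epsilon> * N * (pi * R\<^sup>2)"
    by (simp add: e_def field_simps)
  finally have "(\<integral>\<^sup>+z\<in>ball 0 R. ennreal (norm (z * deriv f z / f z - of_real N)) \<partial>lborel)
            \<le> ennreal (\<epsilon> * N * (pi * R\<^sup>2))" by (simp add: ennreal_leI add_left_mono)
  then show ?thesis using R RR0 N by blast
qed

lemma AE_norm_neq: "AE z in (lborel :: complex measure). norm z \<noteq> r"
proof -
  have "sphere 0 r \<in> null_sets (lborel :: complex measure)"
    using negligible_sphere[of "0::complex" r]
    by (auto simp: null_sets_completion_iff negligible_iff_null_sets)
  then have "AE z in (lborel :: complex measure). z \<notin> sphere 0 r" by (rule AE_not_in)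
  then show ?thesis by (simp add: dist_norm)
qed

lemma directional_mean_close:
  fixes f :: "complex \<Rightarrow> complex" and \<psi> :: "real \<Rightarrow> real" and \<beta> :: real
  assumes f: "f holomorphic_on UNIV" "\<not> f constant_on UNIV" and ord: "entire_order f = 0" and "\<epsilon> > 0"
    and \<psi>: "continuous_on UNIV \<psi>" "\<And>x. 0 \<le> \<psi> x" "\<And>x. \<psi> x \<le> 1"
  defines "c \<equiv> integral {-pi..pi} (\<lambda>x. \<psi> (cos x)) / (2 * pi)"
    and "h \<equiv> \<lambda>z. \<psi> (Re (f z * cis (- \<beta>)) / norm (f z))"
  shows "h \<in> borel_measurable borel"
    and "\<exists>R\<ge>R0. R > 0 \<and> \<bar>(\<integral>z. indicator (ball 0 R) z * h z \<partial>lborel) - c * (pi * R\<^sup>2)\<bar> \<le> \<epsilon> * (pi * R\<^sup>2)"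
proof -
  have [measurable]: "f \<in> borel_measurable borel" "deriv f \<in> borel_measurable borel" "\<psi> \<in> borel_measurable borel"
    using f(1) holomorphic_deriv[OF f(1) open_UNIV] \<psi>(1)
    by (auto intro!: borel_measurable_continuous_onI holomorphic_on_imp_continuous_on)
  show hm[measurable]: "h \<in> borel_measurable borel" unfolding h_def by measurable
  obtain R N where R: "R \<ge> R0" "R > 0" and N: "N > 0" and
    I: "(\<integral>\<^sup>+z\<in>ball 0 R. ennreal (norm (z * deriv f z / f z - of_real N)) \<partial>lborel)
            \<le> ennreal (\<epsilon> * N * (pi * R\<^sup>2))"
    using log_deriv_mean_deviation[OF f ord \<open>\<epsilon> > 0\<close>, of R0] by blast
  define F where "F = (\<lambda>z. z * deriv f z / f z)"
  have [measurable]: "F \<in> borel_measurable borel" unfolding F_def by measurable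
  define B where "B = ball (0::complex) R"
  have [measurable]: "B \<in> sets borel" by (simp add: B_def)
  have cint: "(\<lambda>x. \<psi> (cos x)) integrable_on {-pi..pi}"
    by (intro integrable_continuous_real continuous_on_compose2[OF \<psi>(1)] continuous_intros) auto
  have "0 \<le> integral {-pi..pi} (\<lambda>x. \<psi> (cos x))"
    using cint \<psi> by (intro integral_nonneg) auto
  then have c0: "0 \<le> c" by (simp add: c_def)
  have "integral {-pi..pi} (\<lambda>x. \<psi> (cos x)) \<le> integral {-pi..pi} (\<lambda>x. 1)"
    using cint \<psi> by (intro integral_le) auto
  then have c1: "c \<le> 1" by (simp add: c_def)
  define g where "g = (\<lambda>z. h z - c)"
  have g1: "\<bar>g z\<bar> \<le> 1" for z
    using \<psi>(2)[of "Re (f z * cis (- \<beta>)) / norm (f z)"] \<psi>(3)[of "Re (f z * cis (- \<beta>)) / norm (f z)"] c0 c1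
    by (simp add: g_def h_def abs_le_iff)
  have [measurable]: "g \<in> borel_measurable borel" unfolding g_def by measurable
  define d where "d = (\<lambda>z. indicator B z *\<^sub>R (F z - of_real N))"
  have [measurable]: "d \<in> borel_measurable borel" unfolding d_def by measurable
  have nd: "ennreal (norm (d z)) = ennreal (norm (z * deriv f z / f z - of_real N)) * indicator (ball 0 R) z" for z
    by (simp add: d_def B_def F_def indicator_def)
  have Id: "(\<integral>\<^sup>+z. ennreal (norm (d z)) \<partial>lborel) \<le> ennreal (\<epsilon> * N * (pi * R\<^sup>2))"
    using I unfolding nd .
  then have dint: "integrable lborel d"
    by (intro integrableI_bounded) (auto intro: le_less_trans)
  then have "(\<integral>\<^sup>+z. ennreal (norm (d z)) \<partial>lborel) = ennreal (\<integral>z. norm (d z) \<partial>lborel)"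
    by (intro nn_integral_eq_integral) auto
  then have Id': "(\<integral>z. norm (d z) \<partial>lborel) \<le> \<epsilon> * N * (pi * R\<^sup>2)"
    using Id \<open>\<epsilon> > 0\<close> N by (simp add: ennreal_le_iff)
  have Bfin: "emeasure lborel B < \<infinity>" unfolding B_def by (rule emeasure_lborel_ball_finite)
  have iB: "integrable lborel (\<lambda>z. indicator B z * u z)"
    if [measurable]: "u \<in> borel_measurable borel" and "\<And>z. \<bar>u z\<bar> \<le> 1" for u :: "complex \<Rightarrow> real"
  proof (rule Bochner_Integration.integrable_bound)
    show "integrable lborel (indicator B :: complex \<Rightarrow> real)" using Bfin by simp
  qed (use that in \<open>auto simp: indicator_def\<close>)
  have gint: "integrable lborel (\<lambda>z. indicator B z * g z)" by (rule iB) (use g1 in auto)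
  have gd: "integrable lborel (\<lambda>z. g z * Re (d z))"
  proof (rule Bochner_Integration.integrable_bound[OF dint])
    have "norm (g z * Re (d z)) \<le> norm (d z)" for z
    proof -
      have "\<bar>g z\<bar> * \<bar>Re (d z)\<bar> \<le> 1 * norm (d z)"
        using g1[of z] by (intro mult_mono abs_Re_le_cmod) auto
      then show ?thesis by (simp add: abs_mult)
    qed
    then show "AE z in lborel. norm (g z * Re (d z)) \<le> norm (d z)" by simp
  qed measurable
  \<comment> \<open>Splitting \<open>F\<close> as \<open>N\<close> plus its deviation: the left side
    integrates to zero, so \<open>N\<close> times the integral of \<open>g\<close> is minus that of
    \<open>g * Re d\<close>, and |g| \<le> 1 bounds the latter by the mean deviation of
    \<open>F\<close>.\<close>
  have dec: "indicator B z * (g z * Re (F z)) = g z * Re (d z) + N * (indicator B z * g z)" for z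
    by (simp add: d_def indicator_def algebra_simps)
  have vint: "integrable lborel (\<lambda>z. indicator B z * (g z * Re (F z)))"
    unfolding dec using gint gd by (intro Bochner_Integration.integrable_add integrable_mult_right)
  \<comment> \<open>The circle identity needs a circle free of zeros; the finitely many exceptional
    circles have area zero.\<close>
  have AEz: "AE z in (lborel :: complex measure). \<forall>a\<in>{a. f a = 0} \<inter> cball 0 R. norm z \<noteq> norm a"
    by (intro AE_finite_allI entire_zeros_finite[OF f] AE_norm_neq)
  have zero: "(\<integral>z. indicator B z * (g z * Re (F z)) \<partial>lborel) = 0"
    unfolding B_def
  proof (rule integral_zero_if_circle_means_zero)
    show "AE z in lborel. z \<in> ball 0 R \<longrightarrow> (LINT t|restrict_space lborel {0..2 * pi}. g (cis t * z) * Re (F (cis t * z))) = 0"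
      using AEz
    proof eventually_elim
      case (elim z)
      show ?case
      proof
        assume z: "z \<in> ball 0 R"
        have "f (cis t * z) \<noteq> 0" for t
        proof
          assume "f (cis t * z) = 0"
          then have "cis t * z \<in> {a. f a = 0} \<inter> cball 0 R" using z by (simp add: norm_mult)
          with elim have "norm z \<noteq> norm (cis t * z)" by blast
          then show False by (simp add: norm_mult)
        qed
        from circle_integral_argument_zero[OF f(1) this \<psi>(1), of \<beta>]
        show "(LINT t|restrict_space lborel {0..2 * pi}. g (cis t * z) * Re (F (cis t * z))) = 0"
          unfolding g_def h_def F_def c_def .
      qed
    qed
  qed (use vint B_def in simp)
  have "(\<integral>z. g z * Re (d z) \<partial>lborel) + N * (\<integral>z. indicator B z * g z \<partial>lborel) = 0"
    using zero gint gd unfolding dec by (subst (asm) Bochner_Integration.integral_add) auto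
  then have "N * (\<integral>z. indicator B z * g z \<partial>lborel) = - (\<integral>z. g z * Re (d z) \<partial>lborel)" by linarith
  then have "\<bar>N * (\<integral>z. indicator B z * g z \<partial>lborel)\<bar> = \<bar>\<integral>z. g z * Re (d z) \<partial>lborel\<bar>"
    by (simp only: abs_minus_cancel)
  then have "N * \<bar>\<integral>z. indicator B z * g z \<partial>lborel\<bar> = \<bar>\<integral>z. g z * Re (d z) \<partial>lborel\<bar>"
    using N by (simp only: abs_mult abs_of_pos)
  also have "\<dots> \<le> (\<integral>z. \<bar>g z * Re (d z)\<bar> \<partial>lborel)" by (rule integral_abs_bound)
  also have "\<dots> \<le> (\<integral>z. norm (d z) \<partial>lborel)"
  proof (rule integral_mono)
    fix z
    have "\<bar>g z\<bar> * \<bar>Re (d z)\<bar> \<le> 1 * norm (d z)"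
      using g1[of z] by (intro mult_mono abs_Re_le_cmod) auto
    then show "\<bar>g z * Re (d z)\<bar> \<le> norm (d z)" by (simp add: abs_mult)
  qed (use gd dint in auto)
  also have "\<dots> \<le> N * (\<epsilon> * (pi * R\<^sup>2))" using Id' by (simp add: mult_ac)
  finally have "\<bar>\<integral>z. indicator B z * g z \<partial>lborel\<bar> \<le> \<epsilon> * (pi * R\<^sup>2)" using N by simp
  moreover have "(\<integral>z. indicator B z * g z \<partial>lborel) = (\<integral>z. indicator B z * h z \<partial>lborel) - c * (pi * R\<^sup>2)"
  proof -
    have hint: "integrable lborel (\<lambda>z. indicator B z * h z)"
      by (rule iB) (use \<psi> in \<open>auto simp: h_def\<close>)
    have "(\<integral>z. indicator B z * g z \<partial>lborel) = (\<integral>z. indicator B z * h z - c * indicator B z \<partial>lborel)"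
      by (simp add: g_def algebra_simps)
    also have "\<dots> = (\<integral>z. indicator B z * h z \<partial>lborel) - (\<integral>z. c * indicator B z \<partial>lborel)"
      using hint Bfin by (intro Bochner_Integration.integral_diff) auto
    also have "(\<integral>z. c * indicator B z \<partial>lborel) = c * (pi * R\<^sup>2)"
      using R by (simp add: B_def content_ball unit_ball_vol_2)
    finally show ?thesis .
  qed
  ultimately show "\<exists>R\<ge>R0. R > 0 \<and> \<bar>(\<integral>z. indicator (ball 0 R) z * h z \<partial>lborel) - c * (pi * R\<^sup>2)\<bar> \<le> \<epsilon> * (pi * R\<^sup>2)"
    using R by (auto simp: B_def)
qed

section \<open>From continuous functions of the direction to the sector\<close>

lemma relative_area_integral:
  assumes "f -` S \<in> sets borel" "R > 0"
  shows "relative_area R S f = (\<integral>z. indicator (ball 0 R) z * indicator (f -` S) z \<partial>lborel) / (pi * R\<^sup>2)"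
proof -
  have "(\<integral>z. indicator (ball 0 R) z * indicator (f -` S) z \<partial>lborel) =
      (\<integral>z. indicat_real (f -` S \<inter> ball 0 R) z \<partial>lborel)"
    by (intro Bochner_Integration.integral_cong) (auto simp: indicator_def)
  then show ?thesis
    using assms by (simp add: relative_area_def content_ball unit_ball_vol_2)
qed

lemma continuous_cutoff:
  fixes a b :: real
  assumes "a < b"
  obtains \<psi> :: "real \<Rightarrow> real" where "continuous_on UNIV \<psi>" "\<And>x. 0 \<le> \<psi> x" "\<And>x. \<psi> x \<le> 1"
    "\<And>x. x \<ge> b \<Longrightarrow> \<psi> x = 1" "\<And>x. x \<le> a \<Longrightarrow> \<psi> x = 0"
proof
  let ?\<psi> = "\<lambda>x. max 0 (min 1 ((x - a) / (b - a)))"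
  show "continuous_on UNIV ?\<psi>" using assms by (intro continuous_intros) auto
  show "?\<psi> x = 1" if "x \<ge> b" for x using assms that by (simp add: field_simps)
  show "?\<psi> x = 0" if "x \<le> a" for x using assms that by (simp add: divide_nonpos_pos)
qed auto

text \<open>For \<open>x\<close> in [-pi, pi] outside [-\<kappa>, \<kappa>] the cosine is at most
  cos \<kappa>, so the integrand is dominated by the indicator of an interval of length
  2\<kappa>.\<close>

lemma cos_mean_le:
  assumes \<psi>: "continuous_on UNIV \<psi>" "\<And>x. \<psi> x \<le> 1" "\<And>x. x \<le> cos \<kappa> \<Longrightarrow> \<psi> x = (0::real)"
    and \<kappa>: "0 \<le> \<kappa>" "\<kappa> \<le> pi"
  shows "integral {-pi..pi} (\<lambda>x. \<psi> (cos x)) \<le> 2 * \<kappa>"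
proof -
  have cint: "(\<lambda>x. \<psi> (cos x)) integrable_on {-pi..pi}"
    by (intro integrable_continuous_real continuous_on_compose2[OF \<psi>(1)] continuous_intros) auto
  have "((\<lambda>x. 1::real) has_integral 2 * \<kappa>) {-\<kappa>..\<kappa>}"
    using has_integral_const_real[of "1::real" "-\<kappa>" \<kappa>] \<kappa> by simp
  then have I: "((\<lambda>x. if x \<in> {-\<kappa>..\<kappa>} then 1 else 0::real) has_integral 2 * \<kappa>) {-pi..pi}"
    using \<kappa> by (subst has_integral_restrict) auto
  show ?thesis
  proof (rule has_integral_le[OF integrable_integral[OF cint] I])
    fix x assume x: "x \<in> {-pi..pi}"
    show "\<psi> (cos x) \<le> (if x \<in> {-\<kappa>..\<kappa>} then 1 else 0)"
    proof (cases "x \<in> {-\<kappa>..\<kappa>}")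
      case False
      then have "cos \<bar>x\<bar> \<le> cos \<kappa>" using x \<kappa> by (intro cos_monotone_0_pi_le) auto
      then show ?thesis using False \<psi>(3)[of "cos x"] by auto
    qed (use \<psi> in auto)
  qed
qed

lemma cos_mean_ge:
  assumes \<psi>: "continuous_on UNIV \<psi>" "\<And>x. 0 \<le> \<psi> x" "\<And>x. x \<ge> cos \<kappa> \<Longrightarrow> \<psi> x = (1::real)"
    and \<kappa>: "0 \<le> \<kappa>" "\<kappa> \<le> pi"
  shows "2 * \<kappa> \<le> integral {-pi..pi} (\<lambda>x. \<psi> (cos x))"
proof -
  have cint: "(\<lambda>x. \<psi> (cos x)) integrable_on {-pi..pi}"
    by (intro integrable_continuous_real continuous_on_compose2[OF \<psi>(1)] continuous_intros) auto
  have "((\<lambda>x. 1::real) has_integral 2 * \<kappa>) {-\<kappa>..\<kappa>}"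
    using has_integral_const_real[of "1::real" "-\<kappa>" \<kappa>] \<kappa> by simp
  then have I: "((\<lambda>x. if x \<in> {-\<kappa>..\<kappa>} then 1 else 0::real) has_integral 2 * \<kappa>) {-pi..pi}"
    using \<kappa> by (subst has_integral_restrict) auto
  show ?thesis
  proof (rule has_integral_le[OF I integrable_integral[OF cint]])
    fix x assume x: "x \<in> {-pi..pi}"
    show "(if x \<in> {-\<kappa>..\<kappa>} then 1 else 0) \<le> \<psi> (cos x)"
    proof (cases "x \<in> {-\<kappa>..\<kappa>}")
      case True
      then have "cos \<kappa> \<le> cos \<bar>x\<bar>" using \<kappa> by (intro cos_monotone_0_pi_le) auto
      then show ?thesis using True \<psi>(3)[of "cos x"] by auto
    qed (use \<psi> in auto)
  qed
qed

text \<open>Since \<open>R0\<close> and \<eta> are arbitrary, each bound holds at arbitrarily large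
  radii, which is what an upper bound for the lower limit and a lower bound for the upper limit
  require.\<close>

lemma relative_area_sector_near_opening:
  fixes f :: "complex \<Rightarrow> complex"
  assumes f: "f holomorphic_on UNIV" "\<not> f constant_on UNIV" and ord: "entire_order f = 0"
    and \<theta>: "0 < \<theta>2 - \<theta>1" "\<theta>2 - \<theta>1 \<le> 2 * pi" and "\<eta> > 0"
  shows "\<exists>R\<ge>R0. relative_area R (sector \<theta>1 \<theta>2) f \<le> (\<theta>2 - \<theta>1) / (2 * pi) + \<eta>"
    and "\<exists>R\<ge>R0. (\<theta>2 - \<theta>1) / (2 * pi) - \<eta> \<le> relative_area R (sector \<theta>1 \<theta>2) f"
proof -
  define S where "S = sector \<theta>1 \<theta>2"
  define \<kappa> where "\<kappa> = (\<theta>2 - \<theta>1) / 2"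
  define \<beta> where "\<beta> = (\<theta>1 + \<theta>2) / 2"
  have \<kappa>: "0 < \<kappa>" "\<kappa> \<le> pi" using \<theta> by (auto simp: \<kappa>_def)
  have op: "(\<theta>2 - \<theta>1) / (2 * pi) = \<kappa> / pi" by (simp add: \<kappa>_def)
  define X where "X = (\<lambda>z. Re (f z * cis (- \<beta>)) / norm (f z))"
  have S_iff: "z \<in> f -` S \<longleftrightarrow> f z \<noteq> 0 \<and> X z > cos \<kappa>" for z
    using sector_iff[of \<theta>1 \<theta>2 "f z"] \<theta> by (simp add: S_def X_def \<kappa>_def \<beta>_def)
  have [measurable]: "f \<in> borel_measurable borel"
    using f(1) by (auto intro!: borel_measurable_continuous_onI holomorphic_on_imp_continuous_on)
  have [measurable]: "X \<in> borel_measurable borel" unfolding X_def by measurable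
  have "{z. f z \<noteq> 0 \<and> X z > cos \<kappa>} \<in> sets borel" by measurable
  also have "{z. f z \<noteq> 0 \<and> X z > cos \<kappa>} = f -` S" using S_iff by blast
  finally have Sm[measurable]: "f -` S \<in> sets borel" .
  \<comment> \<open>One \<epsilon> pays for the change of the half opening, another for the
    equidistribution error, hence \<eta>/2. The second entry keeps the shrunken half opening
    positive.\<close>
  define \<epsilon> where "\<epsilon> = min (\<eta> / 2) (\<kappa> / (2 * pi))"
  have \<epsilon>: "\<epsilon> > 0" "\<epsilon> \<le> \<eta> / 2" using \<open>\<eta> > 0\<close> \<kappa> by (auto simp: \<epsilon>_def)
  have \<epsilon>\<kappa>: "pi * \<epsilon> < \<kappa>"
  proof -
    have "pi * \<epsilon> \<le> pi * (\<kappa> / (2 * pi))" by (intro mult_left_mono) (auto simp: \<epsilon>_def)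
    then show ?thesis using \<kappa> by simp
  qed
  have iB: "integrable lborel (\<lambda>z. indicator (ball 0 R) z * u z)"
    if [measurable]: "u \<in> borel_measurable borel" and "\<And>z. \<bar>u z\<bar> \<le> 1" for u :: "complex \<Rightarrow> real" and R
  proof (rule Bochner_Integration.integrable_bound)
    show "integrable lborel (indicator (ball 0 R) :: complex \<Rightarrow> real)"
      using emeasure_lborel_ball_finite by (intro integrable_real_indicator) auto
    show "(\<lambda>z. indicator (ball 0 R) z * u z) \<in> borel_measurable lborel"
      by (simp add: borel_measurable_indicator borel_measurable_times)
  qed (use that in \<open>auto simp: indicator_def\<close>)
  have iS: "integrable lborel (\<lambda>z. indicator (ball 0 R) z * indicator (f -` S) z :: real)" for R
    by (rule iB[OF borel_measurable_indicator[OF Sm]]) (simp add: indicator_def)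
  show "\<exists>R\<ge>R0. relative_area R (sector \<theta>1 \<theta>2) f \<le> (\<theta>2 - \<theta>1) / (2 * pi) + \<eta>"
  proof -
    \<comment> \<open>Widening the half opening by pi \<epsilon> raises the mean by at most
      \<epsilon>; the cap at pi keeps it in the range where the cosine is monotone.\<close>
    define \<kappa>' where "\<kappa>' = min pi (\<kappa> + pi * \<epsilon>)"
    have \<kappa>': "\<kappa> \<le> \<kappa>'" "\<kappa>' \<le> pi" "\<kappa>' \<le> \<kappa> + pi * \<epsilon>" using \<kappa> \<epsilon> by (auto simp: \<kappa>'_def)
    obtain \<psi> :: "real \<Rightarrow> real" where \<psi>: "continuous_on UNIV \<psi>" "\<And>x. 0 \<le> \<psi> x" "\<And>x. \<psi> x \<le> 1"
      and \<psi>1: "\<And>x. x > cos \<kappa> \<Longrightarrow> \<psi> x = 1"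
      and mean: "integral {-pi..pi} (\<lambda>x. \<psi> (cos x)) \<le> 2 * \<kappa>'"
    \<comment> \<open>For the full opening there is no room to widen, and the constant 1 serves as
      majorant.\<close>
    proof (cases "\<kappa> = pi")
      case True
      then have "\<kappa>' = pi" using \<kappa>' by simp
      then show ?thesis by (intro that[of "\<lambda>_. 1"]) auto
    next
      case False
      then have "\<kappa> < \<kappa>'" using \<kappa> \<epsilon> by (simp add: \<kappa>'_def)
      then have "cos \<kappa>' < cos \<kappa>" using \<kappa> \<kappa>' by (intro cos_monotone_0_pi) auto
      then obtain \<psi> :: "real \<Rightarrow> real" where \<psi>: "continuous_on UNIV \<psi>" "\<And>x. 0 \<le> \<psi> x" "\<And>x. \<psi> x \<le> 1"
        "\<And>x. x \<ge> cos \<kappa> \<Longrightarrow> \<psi> x = 1" "\<And>x. x \<le> cos \<kappa>' \<Longrightarrow> \<psi> x = 0"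
        using continuous_cutoff by blast
      show ?thesis
        by (rule that[of \<psi>]) (use \<psi> \<kappa> \<kappa>' cos_mean_le[of \<psi> \<kappa>'] in auto)
    qed
    define c where "c = integral {-pi..pi} (\<lambda>x. \<psi> (cos x)) / (2 * pi)"
    have c: "c \<le> \<kappa> / pi + \<epsilon>"
    proof -
      have "c \<le> (2 * (\<kappa> + pi * \<epsilon>)) / (2 * pi)"
        unfolding c_def using mean \<kappa>'(3) by (intro divide_right_mono) auto
      then show ?thesis by (simp add: field_simps)
    qed
    have hm: "(\<lambda>z. \<psi> (X z)) \<in> borel_measurable borel"
      unfolding X_def by (rule directional_mean_close(1)[OF f ord \<epsilon>(1) \<psi>])
    obtain R where R: "R \<ge> R0" "R > 0"
      and close: "\<bar>(\<integral>z. indicator (ball 0 R) z * \<psi> (X z) \<partial>lborel) - c * (pi * R\<^sup>2)\<bar> \<le> \<epsilon> * (pi * R\<^sup>2)"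
      using directional_mean_close(2)[OF f ord \<epsilon>(1) \<psi>, of R0 \<beta>] unfolding X_def c_def by blast
    have "(\<integral>z. indicator (ball 0 R) z * indicator (f -` S) z \<partial>lborel) \<le> (\<integral>z. indicator (ball 0 R) z * \<psi> (X z) \<partial>lborel)"
    proof (rule integral_mono[OF iS])
      show "integrable lborel (\<lambda>z. indicator (ball 0 R) z * \<psi> (X z))"
        by (rule iB[OF hm]) (use \<psi> in auto)
      show "indicator (ball 0 R) z * indicator (f -` S) z \<le> indicator (ball 0 R) z * \<psi> (X z)" for z
        using S_iff[of z] \<psi>1[of "X z"] \<psi>(2)[of "X z"] by (auto simp: indicator_def)
    qed
    also have "\<dots> \<le> (c + \<epsilon>) * (pi * R\<^sup>2)" using close by (simp add: algebra_simps)
    finally have "relative_area R S f \<le> c + \<epsilon>"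
      using R by (simp add: relative_area_integral[OF Sm R(2)] divide_le_eq)
    also have "\<dots> \<le> \<kappa> / pi + \<eta>" using c \<epsilon> by linarith
    finally show ?thesis using R unfolding op S_def by blast
  qed
  show "\<exists>R\<ge>R0. (\<theta>2 - \<theta>1) / (2 * pi) - \<eta> \<le> relative_area R (sector \<theta>1 \<theta>2) f"
  proof -
    define \<kappa>' where "\<kappa>' = \<kappa> - pi * \<epsilon>"
    have \<kappa>': "0 \<le> \<kappa>'" "\<kappa>' < \<kappa>" using \<epsilon> \<epsilon>\<kappa> by (auto simp: \<kappa>'_def)
    have "cos \<kappa> < cos \<kappa>'" using \<kappa> \<kappa>' by (intro cos_monotone_0_pi) auto
    then obtain \<psi> :: "real \<Rightarrow> real" where \<psi>: "continuous_on UNIV \<psi>" "\<And>x. 0 \<le> \<psi> x" "\<And>x. \<psi> x \<le> 1"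
      and \<psi>1: "\<And>x. x \<ge> cos \<kappa>' \<Longrightarrow> \<psi> x = 1" and \<psi>0: "\<And>x. x \<le> cos \<kappa> \<Longrightarrow> \<psi> x = 0"
      using continuous_cutoff by blast
    have mean: "2 * \<kappa>' \<le> integral {-pi..pi} (\<lambda>x. \<psi> (cos x))"
      using \<psi> \<psi>1 \<kappa> \<kappa>' by (intro cos_mean_ge) auto
    define c where "c = integral {-pi..pi} (\<lambda>x. \<psi> (cos x)) / (2 * pi)"
    have c: "c \<ge> \<kappa> / pi - \<epsilon>"
    proof -
      have "(2 * (\<kappa> - pi * \<epsilon>)) / (2 * pi) \<le> c"
        unfolding c_def using mean by (intro divide_right_mono) (auto simp: \<kappa>'_def)
      then show ?thesis by (simp add: field_simps)
    qed
    have hm: "(\<lambda>z. \<psi> (X z)) \<in> borel_measurable borel"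
      unfolding X_def by (rule directional_mean_close(1)[OF f ord \<epsilon>(1) \<psi>])
    obtain R where R: "R \<ge> R0" "R > 0"
      and close: "\<bar>(\<integral>z. indicator (ball 0 R) z * \<psi> (X z) \<partial>lborel) - c * (pi * R\<^sup>2)\<bar> \<le> \<epsilon> * (pi * R\<^sup>2)"
      using directional_mean_close(2)[OF f ord \<epsilon>(1) \<psi>, of R0 \<beta>] unfolding X_def c_def by blast
    \<comment> \<open>At a zero of \<open>f\<close> division by zero makes \<open>X z\<close> equal
      to 0, which may exceed cos \<kappa> although the zero is not in the preimage. The minorant is
      therefore valid only almost everywhere, whereas the majorant above is valid at every
      point.\<close>
    have AEf: "AE z in lborel. z \<notin> {a. f a = 0} \<inter> cball 0 R"
      by (intro AE_not_in finite_imp_null_set_lborel entire_zeros_finite f)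
    have "(c - \<epsilon>) * (pi * R\<^sup>2) \<le> (\<integral>z. indicator (ball 0 R) z * \<psi> (X z) \<partial>lborel)"
      using close by (simp add: algebra_simps)
    also have "\<dots> \<le> (\<integral>z. indicator (ball 0 R) z * indicator (f -` S) z \<partial>lborel)"
    proof (rule integral_mono_AE[OF _ iS])
      show "integrable lborel (\<lambda>z. indicator (ball 0 R) z * \<psi> (X z))"
        by (rule iB[OF hm]) (use \<psi> in auto)
      show "AE z in lborel. indicator (ball 0 R) z * \<psi> (X z) \<le> indicator (ball 0 R) z * indicator (f -` S) z"
        using AEf
      proof eventually_elim
        case (elim z)
        then show ?case
          using S_iff[of z] \<psi>0[of "X z"] \<psi>(3)[of "X z"] by (cases "X z > cos \<kappa>") (auto simp: indicator_def)
      qed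
    qed
    finally have "c - \<epsilon> \<le> relative_area R S f"
      using R by (simp add: relative_area_integral[OF Sm R(2)] le_divide_eq)
    then have "\<kappa> / pi - \<eta> \<le> relative_area R S f" using c \<epsilon> by linarith
    then show ?thesis using R unfolding op S_def by blast
  qed
qed

theorem corollary1p4:
  fixes f :: "complex \<Rightarrow> complex" and \<theta>\<^sub>1 \<theta>\<^sub>2 \<alpha> :: real and S :: "complex set"
  assumes "f holomorphic_on UNIV"
    and "\<not> f constant_on UNIV"
    and "entire_order f = 0"
    and "S = sector \<theta>\<^sub>1 \<theta>\<^sub>2"
    and "\<alpha> = \<theta>\<^sub>2 - \<theta>\<^sub>1"
    and "0 < \<alpha>" and "\<alpha> \<le> 2 * pi"
  shows "Liminf at_top (\<lambda>r. ereal (relative_area r S f)) \<le> ereal (\<alpha> / (2 * pi)) \<and>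
         ereal (\<alpha> / (2 * pi)) \<le> Limsup at_top (\<lambda>r. ereal (relative_area r S f))"
proof
  have th: "0 < \<theta>\<^sub>2 - \<theta>\<^sub>1" "\<theta>\<^sub>2 - \<theta>\<^sub>1 \<le> 2 * pi" using assms by auto
  note near = relative_area_sector_near_opening[OF assms(1-3) th, folded assms(4,5)]
  show "Liminf at_top (\<lambda>r. ereal (relative_area r S f)) \<le> ereal (\<alpha> / (2 * pi))"
  proof (rule ereal_le_epsilon2, rule ccontr)
    fix e :: real assume e: "e > 0"
    assume "\<not> Liminf at_top (\<lambda>r. ereal (relative_area r S f)) \<le> ereal (\<alpha> / (2 * pi)) + ereal e"
    then have "ereal (\<alpha> / (2 * pi) + e) < Liminf at_top (\<lambda>r. ereal (relative_area r S f))" by simp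
    then have "eventually (\<lambda>r. ereal (\<alpha> / (2 * pi) + e) < ereal (relative_area r S f)) at_top"
      by (rule less_LiminfD)
    then obtain R0 where "\<And>r. r \<ge> R0 \<Longrightarrow> \<alpha> / (2 * pi) + e < relative_area r S f"
      by (auto simp: eventually_at_top_linorder)
    then show False using near(1)[OF e, of R0] by (meson not_le)
  qed
  show "ereal (\<alpha> / (2 * pi)) \<le> Limsup at_top (\<lambda>r. ereal (relative_area r S f))"
  proof (rule ccontr)
    assume "\<not> ?thesis"
    then have "Limsup at_top (\<lambda>r. ereal (relative_area r S f)) < ereal (\<alpha> / (2 * pi))" by simp
    then obtain y where y: "Limsup at_top (\<lambda>r. ereal (relative_area r S f)) < ereal y" "y < \<alpha> / (2 * pi)"
      using ereal_dense2 by (metis ereal_less(1) less_ereal.simps(1))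
    from Limsup_lessD[OF y(1)] obtain R0 where R0: "\<And>r. r \<ge> R0 \<Longrightarrow> relative_area r S f < y"
      by (auto simp: eventually_at_top_linorder)
    \<comment> \<open>The gap between the opening ratio and \<open>y\<close> is used as
      \<eta>.\<close>
    obtain R where "R \<ge> R0" "\<alpha> / (2 * pi) - (\<alpha> / (2 * pi) - y) \<le> relative_area R S f"
      using near(2)[of "\<alpha> / (2 * pi) - y" R0] y(2) by auto
    then show False using R0[of R] by simp
  qed
qed

end
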